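(* Let $N\ge 1000$, $M\ge0$ and $Q_0\in[2,\sqrt N]$ be real numbers. Let $(u_p)_{M+1\le p\le M+N}$ be a sequence of complex numbers indexed by the primes in $[M+1,M+N]$. Then $$\sum_{q\le Q_0}\ \sum_{\substack{1\le a\le q\\ (a,q)=1}}\ \max_{|\alpha-\frac aq|\le\frac{1}{qQ_0}}\Bigl|\sum_{M+1\le p\le M+N}u_p e(\alpha p)\Bigr|^2\le 1200\,\frac{N\log Q_0}{\log N}\sum_{M+1\le p\le M+N}|u_p|^2,$$ where $q$ runs over the positive integers at most $Q_0$ and the maximum is over real $\alpha$.
   Context: The variable $p$ always denotes a prime number, and sums over $p$ run over primes. We write $e(\alpha)=\exp(2i\pi\alpha)$, and $(a,q)$ is the greatest common divisor of $a$ and $q$. *)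

theory Defs
  imports "HOL-Analysis.Analysis" "HOL-Computational_Algebra.Primes"
begin

definition e :: "real \<Rightarrow> complex" where
  "e \<alpha> = exp (2 * \<i> * of_real pi * of_real \<alpha>)"

definition primes_between :: "real \<Rightarrow> real \<Rightarrow> nat set" where
  "primes_between x y = {p. prime p \<and> x \<le> real p \<and> real p \<le> y}"

definition exp_sum :: "(nat \<Rightarrow> complex) \<Rightarrow> real \<Rightarrow> real \<Rightarrow> real \<Rightarrow> complex" where
  "exp_sum u M N \<alpha> = (\<Sum>p\<in>primes_between (M + 1) (M + N). u p * e (\<alpha> * real p))"

definition major_arc :: "real \<Rightarrow> nat \<Rightarrow> nat \<Rightarrow> real set" where
  "major_arc Q\<^sub>0 a q = {\<alpha>. \<bar>\<alpha> - real a / real q\<bar> \<le> 1 / (real q * Q\<^sub>0)}"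

lemma finite_primes_between: "finite (primes_between x y)"
proof (rule finite_subset)
  show "primes_between x y \<subseteq> {..nat \<lfloor>y\<rfloor>}"
    by (auto simp: primes_between_def le_nat_floor)
qed simp

text \<open>Maxima over an arc are written as suprema; the next lemma shows that they are attained, so
  that the supremum in the complete order of the reals is the maximum.\<close>

lemma SUP_major_arc_attained:
  assumes "Q\<^sub>0 > 0"
  shows "\<exists>\<beta>\<in>major_arc Q\<^sub>0 a q.
           (\<forall>\<alpha>\<in>major_arc Q\<^sub>0 a q. (norm (exp_sum u M N \<alpha>))\<^sup>2 \<le> (norm (exp_sum u M N \<beta>))\<^sup>2) \<and>
           (SUP \<alpha>\<in>major_arc Q\<^sub>0 a q. (norm (exp_sum u M N \<alpha>))\<^sup>2) = (norm (exp_sum u M N \<beta>))\<^sup>2"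
proof -
  let ?f = "\<lambda>\<alpha>. (norm (exp_sum u M N \<alpha>))\<^sup>2"
  have arc: "major_arc Q\<^sub>0 a q = cball (real a / real q) (1 / (real q * Q\<^sub>0))"
    by (auto simp: major_arc_def dist_real_def abs_minus_commute)
  have "compact (major_arc Q\<^sub>0 a q)" "major_arc Q\<^sub>0 a q \<noteq> {}"
    using assms by (auto simp: arc not_less)
  moreover have "continuous_on (major_arc Q\<^sub>0 a q) ?f"
    unfolding exp_sum_def e_def by (intro continuous_intros)
  ultimately obtain \<beta> where \<beta>: "\<beta> \<in> major_arc Q\<^sub>0 a q" "\<forall>\<alpha>\<in>major_arc Q\<^sub>0 a q. ?f \<alpha> \<le> ?f \<beta>"
    using continuous_attains_sup by blast
  then have "(SUP \<alpha>\<in>major_arc Q\<^sub>0 a q. ?f \<alpha>) = ?f \<beta>"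
    by (intro cSup_eq_maximum) auto
  with \<beta> show ?thesis by blast
qed

end

theory Submission
  imports Defs "HOL-Number_Theory.Cong" "HOL-Computational_Algebra.Squarefree"
begin

text \<open>
  Pick in the arc around each fraction $a/q$ a point $\alpha_x$, $x=(a,q)$, at which the maximum is attained, and let
  $S(\alpha)=\sum_p u_p e(\alpha p)$. Everything rests on a large sieve inequality for points with
  multiplicity (\<open>large_sieve\<close>): if every point of a family has at most $m$ points of the family
  within $\delta$ of it modulo 1, then the sum of $|S|^2$ over the family is at most
  $2m(K+1/(K\delta^2))\sum|u_p|^2$, where $K$ bounds the length of the interval of summation.

  The points $\alpha_x$ satisfy this with $m=3$ and $\delta=1/(2Q_0^2)$, because the arc of a fraction does
  not extend beyond any other fraction of denominator at most $Q_0$ (\<open>major_arc_points_spaced\<close>). This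
  yields a bound of about $30N\sum|u_p|^2$, which suffices as long as $\log N\le 39\log Q_0$.

  For smaller $Q_0$ the factor $\log Q_0/\log N$ comes from the primality of $p$. If $r\le R$ is
  squarefree and all $p$ exceed $R$, then the Ramanujan sum $\sum_b e(bp/r)$ over reduced residues is a
  sign that does not depend on $p$. Hence $S(\alpha)$ is, up to sign, the sum of the $S(\alpha+b/r)$, and
  $\frac1r|S(\alpha)|^2\le\sum_b|S(\alpha+b/r)|^2$ (\<open>squarefree_lift\<close>). Summing over $\alpha_x$ and over a
  set of $r$, the large sieve at the points $\alpha_x+b/r$ saves the factor $\sum 1/r$. Two things are
  needed.

  First, the new points must be as well spaced as the old ones. A difference
  $\alpha_y-\alpha_x$ can be close to only one fraction modulo 1 with denominator at most $R^2$, so it is enough to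
  forbid, for each pair $(x,y)$, one prime dividing the denominator of that fraction
  (\<open>exceptional_primes\<close>). If the $r$ are free of primes up to $Q_0^4$, then the exceptional primes exceed
  $Q_0^4$, and since there are at most $Q_0^4/4$ pairs, excluding them changes $\sum 1/r$ by a bounded factor only.

  Secondly, the sum of $1/r$ over the remaining $r\le R$ must be at least of order $\log R/\log Q_0$. Putting
  back the excluded primes one at a time bounds $\log R$ by a constant times
  $\prod(1+1/p)\cdot\sum 1/r$ (\<open>ln_le_sifted\<close>), and $\prod_{p\le n}(1+1/p)\le 4\log n$ by an elementary
  argument of Mertens type (\<open>prod_primes_upto_le\<close>).

  With $R$ about $N^{1/5}$ this gives the constant 1120 up to a small error. The primes up to $R$ are so few that they can be
  estimated trivially.
\<close>

section \<open>The additive character and geometric sums\<close>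

lemma e_add: "e (x + y) = e x * e y"
  by (simp add: e_def ring_distribs exp_add)

lemma e_cis: "e x = cis (2 * pi * x)"
  by (simp add: e_def cis_conv_exp mult_ac)

lemma norm_e [simp]: "norm (e x) = 1"
  by (simp add: e_cis)

lemma e_int [simp]: "e (of_int k) = 1"
  using cis_multiple_2pi[of "of_int k"] by (simp add: e_cis)

lemma e_cnj: "cnj (e x) = e (- x)"
  by (simp add: e_cis cis_cnj)

lemma e_mult_nat: "e (x * real n) = e x ^ n"
  by (simp add: e_cis Complex.DeMoivre ac_simps)

lemma e_eq_1_iff: "e x = 1 \<longleftrightarrow> x \<in> \<int>"
proof
  assume "e x = 1"
  then obtain n :: int where "Im (2 * \<i> * of_real pi * of_real x) = of_int (2 * n) * pi"
    unfolding e_def exp_eq_1 by blast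
  then have "x = of_int n" by simp
  then show "x \<in> \<int>" by simp
next
  assume "x \<in> \<int>"
  then show "e x = 1" by (auto elim!: Ints_cases)
qed

text \<open>The graph of the concave function $\sin$ on $[0,\pi/2]$ lies above its chord.\<close>

lemma two_mult_le_sin_pi:
  assumes "0 \<le> t" "t \<le> 1 / 2"
  shows "2 * t \<le> sin (pi * t)"
proof -
  have "convex_on {0..pi/2} (\<lambda>x. - sin x)"
  proof (rule f''_ge0_imp_convex[where f' = "\<lambda>x. - cos x" and f'' = sin])
    fix x :: real assume "x \<in> {0..pi/2}"
    then show "0 \<le> sin x" by (intro sin_ge_zero) auto
  qed (auto intro!: derivative_eq_intros)
  then have "- sin ((1 - 2*t) *\<^sub>R 0 + (2*t) *\<^sub>R (pi/2)) \<le> (1 - 2*t) * (- sin 0) + (2*t) * (- sin (pi/2))"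
    by (rule convex_onD) (use assms in auto)
  then show ?thesis by (simp add: mult.commute)
qed

lemma norm_e_minus_1_ge:
  assumes "\<bar>t\<bar> \<le> 1 / 2"
  shows "4 * \<bar>t\<bar> \<le> norm (e t - 1)"
proof -
  have *: "4 * t \<le> norm (e t - 1)" if "0 \<le> t" "t \<le> 1/2" for t
  proof -
    have "(norm (e t - 1))\<^sup>2 = (cos (2*pi*t) - 1)\<^sup>2 + (sin (2*pi*t))\<^sup>2"
      by (simp add: e_cis cmod_power2)
    also have "\<dots> = 2 - 2 * cos (2 * (pi*t))"
      using sin_cos_squared_add[of "2*pi*t"] by (simp add: power2_eq_square algebra_simps)
    also have "\<dots> = (2 * sin (pi*t))\<^sup>2"
      by (subst cos_double_sin) (simp add: power2_eq_square)
    finally have "norm (e t - 1) = \<bar>2 * sin (pi*t)\<bar>"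
      by (metis abs_norm_cancel power2_eq_iff real_sqrt_abs)
    with two_mult_le_sin_pi[OF that] show ?thesis by linarith
  qed
  show ?thesis
  proof (cases "0 \<le> t")
    case False
    have "norm (e t - 1) = norm (cnj (e t - 1))" by (rule complex_mod_cnj[symmetric])
    also have "\<dots> = norm (e (- t) - 1)" by (simp add: e_cnj)
    finally show ?thesis using *[of "- t"] assms False by simp
  qed (use * assms in auto)
qed

lemma norm_geometric_e_le:
  assumes "\<bar>\<theta> - of_int k\<bar> \<le> 1 / 2"
  shows "norm (\<Sum>j<K. e (\<theta> * real j)) * (2 * \<bar>\<theta> - of_int k\<bar>) \<le> 1"
proof -
  have eq: "e \<theta> = e (\<theta> - of_int k)"
    using e_add[of "\<theta> - of_int k" "of_int k"] by simp
  have "(e \<theta> - 1) * (\<Sum>j<K. e (\<theta> * real j)) = e \<theta> ^ K - 1"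
    by (simp add: e_mult_nat power_diff_1_eq)
  then have "norm (e \<theta> - 1) * norm (\<Sum>j<K. e (\<theta> * real j)) = norm (e \<theta> ^ K - 1)"
    by (metis norm_mult)
  also have "\<dots> \<le> 2"
    using norm_triangle_ineq4[of "e \<theta> ^ K" 1] by (simp add: norm_power)
  finally have "norm (e \<theta> - 1) * norm (\<Sum>j<K. e (\<theta> * real j)) \<le> 2" .
  moreover have "4 * \<bar>\<theta> - of_int k\<bar> \<le> norm (e \<theta> - 1)"
    unfolding eq by (rule norm_e_minus_1_ge) (fact assms)
  then have "4 * \<bar>\<theta> - of_int k\<bar> * norm (\<Sum>j<K. e (\<theta> * real j)) \<le> norm (e \<theta> - 1) * norm (\<Sum>j<K. e (\<theta> * real j))"
    by (rule mult_right_mono) simp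
  ultimately show ?thesis by (simp add: algebra_simps)
qed

lemma sum_inverse_squares_le:
  "(\<Sum>k\<in>{1..n}. 1 / (real k)\<^sup>2) \<le> 7 / 4"
proof -
  have "n < 2 \<or> (\<Sum>k\<in>{1..n}. 1 / (real k)\<^sup>2) \<le> 7 / 4 - 1 / real n"
  proof (induction n)
    case (Suc n)
    show ?case
    proof (cases "n < 2")
      case True
      then have "n = 0 \<or> n = 1" by auto
      then show ?thesis by (auto simp: numeral_2_eq_2)
    next
      case False
      then have "1 / (real (Suc n))\<^sup>2 \<le> 1 / real n - 1 / real (Suc n)"
        using add_pos_nonneg[of "real n" "real n * real n"]
        by (simp add: divide_simps power2_eq_square algebra_simps)
      then show ?thesis using False Suc by (simp del: of_nat_Suc)
    qed
  qed simp
  moreover have "(\<Sum>k\<in>{1..n}. 1 / (real k)\<^sup>2) \<le> 7 / 4" if "n < 2"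
  proof -
    have "n = 0 \<or> n = 1" using that by auto
    then show ?thesis by auto
  qed
  moreover have "0 \<le> 1 / real n" by simp
  ultimately show ?thesis by linarith
qed

text \<open>Write \<open>t j\<close> for the representative of \<open>pt i - pt j\<close> modulo 1 in $[-1/2,1/2]$. The indices with
  $|t_j|<\delta$ are at most \<open>m\<close> in number and contribute at most $K^2$ each. The other ones are
  sorted by the sign of $t_j$ and by $h=\lfloor|t_j|/\delta\rfloor\ge 1$. Two indices in the same cell are
  closer than $\delta$ to each other, so a cell holds at most \<open>m\<close> of them, and each contributes at
  most $1/(2h\delta)^2$, which is summable over $h$.\<close>

lemma fejer_row_sum:
  fixes A :: "'i set" and pt :: "'i \<Rightarrow> real"
  assumes fin: "finite A" and \<delta>: "\<delta> > 0" and K: "K > 0" and i: "i \<in> A"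
    and m: "\<And>i. i \<in> A \<Longrightarrow> card {j \<in> A. \<exists>k::int. \<bar>pt i - pt j - of_int k\<bar> < \<delta>} \<le> m"
  shows "(\<Sum>j\<in>A. (norm (\<Sum>l<K. e ((pt i - pt j) * real l)))\<^sup>2) \<le> real m * ((real K)\<^sup>2 + 1 / \<delta>\<^sup>2)"
proof -
  define F where "F = (\<lambda>j. (norm (\<Sum>l<K. e ((pt i - pt j) * real l)))\<^sup>2)"
  define t where "t = (\<lambda>j. pt i - pt j - of_int (round (pt i - pt j)))"
  define near where "near = {j \<in> A. \<bar>t j\<bar> < \<delta>}"
  define \<kappa> where "\<kappa> = (\<lambda>j. (t j > 0, nat \<lfloor>\<bar>t j\<bar> / \<delta>\<rfloor>))"
  define H where "H = Max (insert 0 ((snd \<circ> \<kappa>) ` A))"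
  have t_half: "\<bar>t j\<bar> \<le> 1 / 2" for j
    unfolding t_def using of_int_round_abs_le[of "pt i - pt j"] by (simp add: abs_minus_commute)
  have Ft: "sqrt (F j) * (2 * \<bar>t j\<bar>) \<le> 1" for j
    unfolding F_def t_def using norm_geometric_e_le[of "pt i - pt j" "round (pt i - pt j)" K] t_half[of j]
    by (simp add: t_def)
  have F_nonneg: "0 \<le> F j" for j by (simp add: F_def)
  have F_le: "F j \<le> (real K)\<^sup>2" for j
    unfolding F_def
    by (intro power_mono order.trans[OF norm_sum]) auto
  have near: "sum F near \<le> real m * (real K)\<^sup>2"
  proof -
    have "near \<subseteq> {j \<in> A. \<exists>k::int. \<bar>pt i - pt j - of_int k\<bar> < \<delta>}"
      by (auto simp: near_def t_def)
    then have "card near \<le> m"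
      using m[OF i] card_mono[of "{j \<in> A. \<exists>k::int. \<bar>pt i - pt j - of_int k\<bar> < \<delta>}" near] fin by simp
    have "sum F near \<le> real (card near) * (real K)\<^sup>2"
      by (rule sum_bounded_above) (rule F_le)
    also have "\<dots> \<le> real m * (real K)\<^sup>2"
      by (rule mult_right_mono) (use \<open>card near \<le> m\<close> in auto)
    finally show ?thesis .
  qed
  have cell: "sum F {j \<in> A - near. \<kappa> j = (s, h)} \<le> real m * (1 / (4 * \<delta>\<^sup>2) * (1 / (real h)\<^sup>2))"
    if h: "h \<ge> 1" for s h
  proof (cases "{j \<in> A - near. \<kappa> j = (s, h)} = {}")
    case False
    then obtain j0 where j0: "j0 \<in> A" "\<kappa> j0 = (s, h)" by blast
    have bounds: "real h * \<delta> \<le> \<bar>t j\<bar>" "\<bar>t j\<bar> < (real h + 1) * \<delta>" if "\<kappa> j = (s, h)" for j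
    proof -
      have "nat \<lfloor>\<bar>t j\<bar> / \<delta>\<rfloor> = h" using that by (simp add: \<kappa>_def)
      then have "\<lfloor>\<bar>t j\<bar> / \<delta>\<rfloor> = int h" using h by linarith
      then have "real h \<le> \<bar>t j\<bar> / \<delta>" "\<bar>t j\<bar> / \<delta> < real h + 1" by linarith+
      then show "real h * \<delta> \<le> \<bar>t j\<bar>" "\<bar>t j\<bar> < (real h + 1) * \<delta>"
        using \<delta> by (simp_all add: field_simps)
    qed
    have "{j \<in> A - near. \<kappa> j = (s, h)} \<subseteq> {j \<in> A. \<exists>k::int. \<bar>pt j0 - pt j - of_int k\<bar> < \<delta>}"
    proof safe
      fix j assume j: "j \<in> A" "\<kappa> j = (s, h)"
      have "(t j > 0) = (t j0 > 0)" using j j0 by (simp add: \<kappa>_def)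
      then have "\<bar>t j - t j0\<bar> < \<delta>"
        using bounds[OF j(2)] bounds[OF j0(2)] by (auto simp: abs_if algebra_simps split: if_splits)
      moreover have "pt j0 - pt j - of_int (round (pt i - pt j) - round (pt i - pt j0)) = t j - t j0"
        by (simp add: t_def)
      ultimately show "\<exists>k::int. \<bar>pt j0 - pt j - of_int k\<bar> < \<delta>" by metis
    qed
    then have card: "card {j \<in> A - near. \<kappa> j = (s, h)} \<le> m"
      using m[OF j0(1)] card_mono[of "{j \<in> A. \<exists>k::int. \<bar>pt j0 - pt j - of_int k\<bar> < \<delta>}" "{j \<in> A - near. \<kappa> j = (s, h)}"] fin
      by simp
    have "F j \<le> 1 / (4 * \<delta>\<^sup>2) * (1 / (real h)\<^sup>2)" if "\<kappa> j = (s, h)" for j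
    proof -
      have "sqrt (F j) * (2 * (real h * \<delta>)) \<le> 1"
        by (rule order.trans[OF _ Ft[of j]]) (use bounds[OF that] in \<open>intro mult_left_mono; simp add: F_nonneg\<close>)
      then have "sqrt (F j) \<le> 1 / (2 * (real h * \<delta>))"
        using \<delta> h by (simp add: field_simps)
      then have "(sqrt (F j))\<^sup>2 \<le> (1 / (2 * (real h * \<delta>)))\<^sup>2"
        by (intro power_mono) (auto simp: F_nonneg)
      then show ?thesis by (simp add: F_nonneg power_mult_distrib power_divide field_simps)
    qed
    then have "sum F {j \<in> A - near. \<kappa> j = (s, h)}
        \<le> real (card {j \<in> A - near. \<kappa> j = (s, h)}) * (1 / (4 * \<delta>\<^sup>2) * (1 / (real h)\<^sup>2))"
      by (intro sum_bounded_above) auto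
    also have "\<dots> \<le> real m * (1 / (4 * \<delta>\<^sup>2) * (1 / (real h)\<^sup>2))"
      by (rule mult_right_mono) (use card in auto)
    finally show ?thesis .
  qed (simp only: sum.empty, simp)
  have \<kappa>_mem: "\<kappa> ` (A - near) \<subseteq> UNIV \<times> {1..H}"
  proof safe
    fix j s h assume j: "j \<in> A" "j \<notin> near" and eq: "(s, h) = \<kappa> j"
    have "h = nat \<lfloor>\<bar>t j\<bar> / \<delta>\<rfloor>" using eq by (simp add: \<kappa>_def)
    moreover have "1 \<le> \<bar>t j\<bar> / \<delta>" using j \<delta> by (simp add: near_def field_simps)
    ultimately have "1 \<le> h" by linarith
    moreover have "h \<in> (snd \<circ> \<kappa>) ` A"
      using j by (intro image_eqI[of _ _ j]) (simp_all flip: eq)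
    then have "h \<le> H" unfolding H_def using fin by (intro Max_ge) auto
    ultimately show "h \<in> {1..H}" by simp
  qed simp
  have "sum F (A - near) = (\<Sum>y\<in>UNIV \<times> {1..H}. sum F {j \<in> A - near. \<kappa> j = y})"
    by (rule sum.group[symmetric]) (use fin \<kappa>_mem in auto)
  also have "\<dots> = (\<Sum>s\<in>UNIV. \<Sum>h\<in>{1..H}. sum F {j \<in> A - near. \<kappa> j = (s, h)})"
    by (simp add: sum.cartesian_product)
  also have "\<dots> \<le> (\<Sum>s\<in>(UNIV::bool set). \<Sum>h\<in>{1..H}. real m * (1 / (4 * \<delta>\<^sup>2) * (1 / (real h)\<^sup>2)))"
    by (intro sum_mono cell) auto
  also have "\<dots> = real m * (1 / (2 * \<delta>\<^sup>2) * (\<Sum>h\<in>{1..H}. 1 / (real h)\<^sup>2))"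
    by (simp add: sum_distrib_left UNIV_bool field_simps)
  also have "\<dots> \<le> real m * (1 / (2 * \<delta>\<^sup>2) * 2)"
    using sum_inverse_squares_le[of H] by (intro mult_left_mono) auto
  finally have far: "sum F (A - near) \<le> real m * (1 / \<delta>\<^sup>2)" by simp
  have "sum F A = sum F (A - near) + sum F near"
    by (rule sum.subset_diff) (use fin in \<open>auto simp: near_def\<close>)
  with near far show ?thesis unfolding F_def by (simp add: algebra_simps)
qed

section \<open>A large sieve inequality for points with multiplicity\<close>

text \<open>The number of pairs $(i,j)$ with $i,j<K$ and $i-j=d$ is $K-|d|$, and this is at least $K/2$ when
  $|d|\le K/2$. Measured from the middle of the interval every \<open>n \<in> J\<close> is that close, so the
  double sum on the right counts each \<open>g n\<close> at least $K/2$ times. Its weights have the Fejer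
  kernel as Fourier transform, which decays quadratically.\<close>

lemma triangle_majorant:
  fixes g :: "real \<Rightarrow> real"
  assumes J: "J \<subseteq> {n0..<n0+K}" and g: "\<And>x. 0 \<le> g x"
  shows "real K / 2 * (\<Sum>n\<in>J. g (real n))
      \<le> (\<Sum>i<K. \<Sum>j<K. g (real (n0 + K div 2) + real i - real j))"
proof -
  define h where "h = (K + 1) div 2"
  define c where "c = n0 + K div 2"
  \<comment> \<open>With truncated subtraction, the pairs \<open>\<phi> (n, t)\<close> for \<open>t < h\<close> all have difference \<open>n - c\<close>.\<close>
  define \<phi> where "\<phi> = (\<lambda>(n, t). (n - c + t, c - n + t :: nat))"
  have finJ: "finite J" using J finite_subset by blast
  have inj: "inj_on \<phi> (J \<times> {..<h})"
    by (auto simp: inj_on_def \<phi>_def)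
  have img: "\<phi> ` (J \<times> {..<h}) \<subseteq> {..<K} \<times> {..<K}"
    using J by (auto simp: \<phi>_def h_def c_def dest!: subsetD)
  have "real K / 2 * (\<Sum>n\<in>J. g (real n)) \<le> real h * (\<Sum>n\<in>J. g (real n))"
    by (intro mult_right_mono sum_nonneg g) (auto simp: h_def)
  also have "\<dots> = (\<Sum>(n, t)\<in>J \<times> {..<h}. g (real n))"
    by (simp add: sum_distrib_left flip: sum.cartesian_product)
  also have "\<dots> = (\<Sum>z\<in>J \<times> {..<h}. (\<lambda>(i, j). g (real c + real i - real j)) (\<phi> z))"
  proof (rule sum.cong[OF refl])
    fix z assume "z \<in> J \<times> {..<h}"
    obtain n t where z: "z = (n, t)" by (cases z)
    have "real c + real (n - c + t) - real (c - n + t) = real n" by (cases "n \<le> c") auto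
    then show "(case z of (n, t) \<Rightarrow> g (real n)) = (\<lambda>(i, j). g (real c + real i - real j)) (\<phi> z)"
      by (simp add: z \<phi>_def)
  qed
  also have "\<dots> = (\<Sum>(i, j)\<in>\<phi> ` (J \<times> {..<h}). g (real c + real i - real j))"
    by (simp add: sum.reindex[OF inj])
  also have "\<dots> \<le> (\<Sum>(i, j)\<in>{..<K} \<times> {..<K}. g (real c + real i - real j))"
    by (rule sum_mono2) (use img g in auto)
  finally show ?thesis by (simp add: c_def sum.cartesian_product)
qed

lemma fejer_expansion:
  fixes c :: "'i \<Rightarrow> complex" and pt :: "'i \<Rightarrow> real"
  shows "(\<Sum>l<K. \<Sum>l'<K. (norm (\<Sum>i\<in>A. c i * e (pt i * (x + real l - real l'))))\<^sup>2)
    \<le> (\<Sum>i\<in>A. \<Sum>j\<in>A. norm (c i) * norm (c j) * (norm (\<Sum>l<K. e ((pt i - pt j) * real l)))\<^sup>2)"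
proof -
  define D where "D = (\<lambda>\<theta>. \<Sum>l<K. e (\<theta> * real l))"
  have e_split: "e (a * (x + real l - real l')) * e (- (b * (x + real l - real l')))
      = e ((a - b) * x) * (e ((a - b) * real l) * cnj (e ((a - b) * real l')))" for a b l l'
    by (simp add: e_cnj flip: e_add) (simp add: algebra_simps)
  have "complex_of_real (\<Sum>l<K. \<Sum>l'<K. (norm (\<Sum>i\<in>A. c i * e (pt i * (x + real l - real l'))))\<^sup>2)
      = (\<Sum>l<K. \<Sum>l'<K. \<Sum>i\<in>A. \<Sum>j\<in>A. (c i * e (pt i * (x + real l - real l'))) *
            cnj (c j * e (pt j * (x + real l - real l'))))"
    by (simp add: complex_norm_square sum_product del: of_real_power complex_cnj_mult)
  also have "\<dots> = (\<Sum>l<K. \<Sum>l'<K. \<Sum>i\<in>A. \<Sum>j\<in>A. c i * cnj (c j) * e ((pt i - pt j) * x) *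
       (e ((pt i - pt j) * real l) * cnj (e ((pt i - pt j) * real l'))))"
    by (intro sum.cong refl) (use e_split in \<open>simp add: e_cnj mult_ac\<close>)
  also have "\<dots> = (\<Sum>i\<in>A. \<Sum>j\<in>A. \<Sum>l<K. \<Sum>l'<K. c i * cnj (c j) * e ((pt i - pt j) * x) *
       (e ((pt i - pt j) * real l) * cnj (e ((pt i - pt j) * real l'))))"
  proof -
    have swap: "(\<Sum>l<K. \<Sum>l'<K. \<Sum>i\<in>A. g l l' i) = (\<Sum>i\<in>A. \<Sum>l<K. \<Sum>l'<K. g l l' i)"
      for g :: "nat \<Rightarrow> nat \<Rightarrow> 'i \<Rightarrow> complex"
      by (rule trans[OF sum.cong[OF refl sum.swap] sum.swap])
    show ?thesis unfolding swap ..
  qed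
  also have "\<dots> = (\<Sum>i\<in>A. \<Sum>j\<in>A. c i * cnj (c j) * e ((pt i - pt j) * x) *
       (D (pt i - pt j) * cnj (D (pt i - pt j))))"
    unfolding D_def cnj_sum sum_product by (simp only: sum_distrib_left)
  finally have "norm (complex_of_real (\<Sum>l<K. \<Sum>l'<K. (norm (\<Sum>i\<in>A. c i * e (pt i * (x + real l - real l'))))\<^sup>2))
     = norm (\<Sum>i\<in>A. \<Sum>j\<in>A. c i * cnj (c j) * e ((pt i - pt j) * x) *
       (D (pt i - pt j) * cnj (D (pt i - pt j))))" by (rule arg_cong)
  also have "\<dots> \<le> (\<Sum>i\<in>A. \<Sum>j\<in>A. norm (c i * cnj (c j) * e ((pt i - pt j) * x) *
       (D (pt i - pt j) * cnj (D (pt i - pt j)))))"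
    by (intro order.trans[OF norm_sum] sum_mono order.refl)
  also have "\<dots> = (\<Sum>i\<in>A. \<Sum>j\<in>A. norm (c i) * norm (c j) * (norm (D (pt i - pt j)))\<^sup>2)"
    by (simp add: norm_mult power2_eq_square)
  finally have "\<bar>\<Sum>l<K. \<Sum>l'<K. (norm (\<Sum>i\<in>A. c i * e (pt i * (x + real l - real l'))))\<^sup>2\<bar>
    \<le> (\<Sum>i\<in>A. \<Sum>j\<in>A. norm (c i) * norm (c j) * (norm (D (pt i - pt j)))\<^sup>2)"
    by (simp only: norm_of_real)
  then show ?thesis unfolding D_def by linarith
qed

lemma schur_test:
  fixes k :: "'i \<Rightarrow> 'i \<Rightarrow> real"
  assumes nonneg: "\<And>i j. 0 \<le> k i j" and sym: "\<And>i j. k i j = k j i"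
    and row: "\<And>i. i \<in> A \<Longrightarrow> (\<Sum>j\<in>A. k i j) \<le> C"
  shows "(\<Sum>i\<in>A. \<Sum>j\<in>A. w i * w j * k i j) \<le> C * (\<Sum>i\<in>A. (w i)\<^sup>2)"
proof -
  have "w i * w j * k i j \<le> (w i)\<^sup>2 * k i j / 2 + (w j)\<^sup>2 * k i j / 2" for i j
    using mult_right_mono[OF sum_squares_bound[of "w i" "w j"] nonneg[of i j]]
    by (simp add: algebra_simps)
  then have "(\<Sum>i\<in>A. \<Sum>j\<in>A. w i * w j * k i j)
      \<le> (\<Sum>i\<in>A. \<Sum>j\<in>A. (w i)\<^sup>2 * k i j / 2) + (\<Sum>i\<in>A. \<Sum>j\<in>A. (w j)\<^sup>2 * k i j / 2)"
    by (simp add: sum_mono flip: sum.distrib)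
  also have "(\<Sum>i\<in>A. \<Sum>j\<in>A. (w j)\<^sup>2 * k i j / 2) = (\<Sum>i\<in>A. \<Sum>j\<in>A. (w i)\<^sup>2 * k i j / 2)"
    by (subst sum.swap) (simp add: sym)
  also have "(\<Sum>i\<in>A. \<Sum>j\<in>A. (w i)\<^sup>2 * k i j / 2) + (\<Sum>i\<in>A. \<Sum>j\<in>A. (w i)\<^sup>2 * k i j / 2)
      = (\<Sum>i\<in>A. (w i)\<^sup>2 * (\<Sum>j\<in>A. k i j))"
    by (simp add: sum_distrib_right mult.commute flip: sum.distrib)
  also have "\<dots> \<le> (\<Sum>i\<in>A. (w i)\<^sup>2 * C)"
    by (intro sum_mono mult_left_mono row) auto
  finally show ?thesis by (simp add: sum_distrib_left mult.commute)
qed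

text \<open>The duality argument. Choosing the conjugates of the sums \<open>S i\<close> as coefficients, the left-hand side
  \<open>V\<close> equals $\sum_n u_n T(n)$ for the dual sum $T(x)=\sum_i\overline{S_i}\,e(pt_i\,x)$. By
  Cauchy--Schwarz it remains to bound $\sum_n|T(n)|^2$ by a multiple of \<open>V\<close> itself. After
  majorizing the interval as in \<open>triangle_majorant\<close>, opening the square leaves a Hermitian form with the Fejer
  kernel at the differences of the points, and its norm is bounded by the row sums.\<close>

lemma large_sieve:
  fixes A :: "'i set" and pt :: "'i \<Rightarrow> real" and u :: "nat \<Rightarrow> complex"
  assumes fin: "finite A" and \<delta>: "\<delta> > 0" and K: "K > 0"
    and m: "\<And>i. i \<in> A \<Longrightarrow> card {j \<in> A. \<exists>k::int. \<bar>pt i - pt j - of_int k\<bar> < \<delta>} \<le> m"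
    and J: "J \<subseteq> {n0..<n0+K}"
  shows "(\<Sum>i\<in>A. (norm (\<Sum>n\<in>J. u n * e (pt i * real n)))\<^sup>2)
      \<le> 2 * real m * (real K + 1 / (real K * \<delta>\<^sup>2)) * (\<Sum>n\<in>J. (norm (u n))\<^sup>2)"
proof -
  define S where "S = (\<lambda>i. \<Sum>n\<in>J. u n * e (pt i * real n))"
  define V where "V = (\<Sum>i\<in>A. (norm (S i))\<^sup>2)"
  define U where "U = (\<Sum>n\<in>J. (norm (u n))\<^sup>2)"
  define T where "T = (\<lambda>x. \<Sum>i\<in>A. cnj (S i) * e (pt i * x))"
  define C where "C = real m * ((real K)\<^sup>2 + 1 / \<delta>\<^sup>2)"
  have U0: "0 \<le> U" and V0: "0 \<le> V" by (auto simp: U_def V_def intro: sum_nonneg)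
  have "real K / 2 * (\<Sum>n\<in>J. (norm (T (real n)))\<^sup>2)
      \<le> (\<Sum>l<K. \<Sum>l'<K. (norm (T (real (n0 + K div 2) + real l - real l')))\<^sup>2)"
    by (rule triangle_majorant[OF J]) simp
  also have "\<dots> \<le> (\<Sum>i\<in>A. \<Sum>j\<in>A. norm (cnj (S i)) * norm (cnj (S j)) *
      (norm (\<Sum>l<K. e ((pt i - pt j) * real l)))\<^sup>2)"
    unfolding T_def by (rule fejer_expansion)
  also have "\<dots> \<le> C * (\<Sum>i\<in>A. (norm (cnj (S i)))\<^sup>2)"
  proof (rule schur_test)
    fix i j
    have "(\<Sum>l<K. e ((pt i - pt j) * real l)) = cnj (\<Sum>l<K. e ((pt j - pt i) * real l))"
      by (simp add: e_cnj algebra_simps)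
    then show "(norm (\<Sum>l<K. e ((pt i - pt j) * real l)))\<^sup>2 = (norm (\<Sum>l<K. e ((pt j - pt i) * real l)))\<^sup>2"
      by (simp only: complex_mod_cnj)
  qed (use fejer_row_sum[OF fin \<delta> K _ m] in \<open>auto simp: C_def\<close>)
  also have "\<dots> = C * V" by (simp add: V_def)
  finally have dual: "(\<Sum>n\<in>J. (norm (T (real n)))\<^sup>2) \<le> 2 / real K * C * V"
    using K by (simp add: field_simps)
  have "complex_of_real V = (\<Sum>i\<in>A. cnj (S i) * S i)"
    by (simp add: V_def complex_norm_square mult.commute del: of_real_power)
  also have "\<dots> = (\<Sum>n\<in>J. u n * T (real n))"
  proof -
    have "(\<Sum>i\<in>A. cnj (S i) * S i) = (\<Sum>i\<in>A. \<Sum>n\<in>J. u n * (cnj (S i) * e (pt i * real n)))"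
      by (subst (2) S_def) (simp add: sum_distrib_left mult_ac)
    also have "\<dots> = (\<Sum>n\<in>J. u n * T (real n))"
      by (subst sum.swap) (simp add: T_def sum_distrib_left)
    finally show ?thesis .
  qed
  finally have "V = norm (\<Sum>n\<in>J. u n * T (real n))"
    using V0 by (metis abs_of_nonneg norm_of_real)
  also have "\<dots> \<le> (\<Sum>n\<in>J. norm (u n) * norm (T (real n)))"
    by (rule order.trans[OF norm_sum]) (simp add: norm_mult)
  finally have "V\<^sup>2 \<le> (\<Sum>n\<in>J. norm (u n) * norm (T (real n)))\<^sup>2"
    using V0 by (intro power_mono)
  also have "\<dots> \<le> U * (\<Sum>n\<in>J. (norm (T (real n)))\<^sup>2)"
    unfolding U_def by (rule Cauchy_Schwarz_ineq_sum)
  also have "\<dots> \<le> U * (2 / real K * C * V)"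
    by (rule mult_left_mono[OF dual U0])
  finally have VV: "V * V \<le> (2 / real K * C * U) * V"
    by (simp add: power2_eq_square mult_ac)
  have "V \<le> 2 / real K * C * U"
  proof (cases "V = 0")
    case True
    then show ?thesis using U0 by (simp add: C_def)
  next
    case False
    then show ?thesis using VV V0 by (intro mult_right_le_imp_le[OF VV]) simp
  qed
  also have "2 / real K * C = 2 * real m * (real K + 1 / (real K * \<delta>\<^sup>2))"
    using K by (simp add: C_def power2_eq_square field_simps)
  finally show ?thesis by (simp add: V_def U_def S_def)
qed

section \<open>Spacing of points in the arcs\<close>

definition numerators :: "nat \<Rightarrow> nat set" where
  "numerators q = {a. 1 \<le> a \<and> a \<le> q \<and> coprime a q}"

lemma finite_numerators [simp]: "finite (numerators q)"
  by (rule finite_subset[of _ "{1..q}"]) (auto simp: numerators_def)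

lemma card_numerators_le: "card (numerators q) \<le> q"
proof -
  have "numerators q \<subseteq> {1..q}" by (auto simp: numerators_def)
  then show ?thesis using card_mono[of "{1..q}" "numerators q"] by simp
qed

lemma numerators_1 [simp]: "numerators (Suc 0) = {1}"
  by (auto simp: numerators_def)

text \<open>Both fractions lie in $(0,1]$, so congruence modulo 1 means equality, and reduced forms are unique.\<close>

lemma reduced_fraction_eq:
  assumes a: "a \<in> numerators q" and b: "b \<in> numerators r"
    and eq: "real a / real q - real b / real r = of_int k"
  shows "a = b \<and> q = r"
proof -
  have pos: "0 < a" "a \<le> q" "0 < b" "b \<le> r" and cop: "coprime a q" "coprime b r"
    using a b by (auto simp: numerators_def)
  then have "0 < real a / real q" "real a / real q \<le> 1" "0 < real b / real r" "real b / real r \<le> 1"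
    by auto
  then have "k = 0" using eq by linarith
  then have "real a * real r = real b * real q" using eq pos by (simp add: field_simps)
  then have ar: "a * r = b * q" by (metis of_nat_eq_iff of_nat_mult)
  have "q dvd r" using cop(1) ar by (metis coprime_commute coprime_dvd_mult_right_iff dvd_triv_right)
  moreover have "r dvd q" using cop(2) ar by (metis coprime_commute coprime_dvd_mult_right_iff dvd_triv_right)
  ultimately have "q = r" by (rule dvd_antisym)
  then show ?thesis using ar pos by auto
qed

lemma rational_gap:
  assumes "real d * x \<in> \<int>" "x \<noteq> 0" "d > 0"
  shows "1 / real d \<le> \<bar>x\<bar>"
proof -
  have "1 \<le> \<bar>real d * x\<bar>" using assms by (intro Ints_nonzero_abs_ge1) auto
  then show ?thesis using assms(3) by (simp add: abs_mult field_simps)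
qed

text \<open>Lift the points $\alpha_y$ that are close to \<open>t\<close> modulo 1 to points $b_y\in(t-\delta,t+\delta)$, and shift
  their fractions along to $f_y$, so that $|b_y-f_y|\le 1/(qQ)$. Two fractions with
  denominators $q,q'\le Q$ differ by at least $1/(qq')\ge 1/(qQ)$. Hence the arc of a fraction never extends
  beyond another such fraction: of two fractions to the right of $(t-\delta,t+\delta)$ the farther one
  cannot have its point inside. So there is at most one fraction on the right, at most one on
  the left, and at most one inside, because the length $2\delta$ is at most the minimal gap $1/Q^2$.\<close>

lemma major_arc_points_spaced:
  fixes \<alpha> :: "nat \<times> nat \<Rightarrow> real"
  assumes X: "X \<subseteq> {(a, q). real q \<le> Q \<and> a \<in> numerators q}" and fin: "finite X" and Q: "Q > 0"
    and \<alpha>: "\<And>a q. (a, q) \<in> X \<Longrightarrow> \<bar>\<alpha> (a, q) - real a / real q\<bar> \<le> 1 / (real q * Q)"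
    and \<delta>: "2 * \<delta> \<le> 1 / Q\<^sup>2"
  shows "card {y \<in> X. \<exists>k::int. \<bar>t - \<alpha> y - of_int k\<bar> < \<delta>} \<le> 3"
proof -
  define Y where "Y = {y \<in> X. \<exists>k::int. \<bar>t - \<alpha> y - of_int k\<bar> < \<delta>}"
  define k where "k = (\<lambda>y. SOME k::int. \<bar>t - \<alpha> y - of_int k\<bar> < \<delta>)"
  define f where "f = (\<lambda>y. real (fst y) / real (snd y) + of_int (k y))"
  define b where "b = (\<lambda>y. \<alpha> y + of_int (k y))"
  have finY: "finite Y" using fin by (simp add: Y_def)
  have q: "0 < snd y" "real (snd y) \<le> Q" "fst y \<in> numerators (snd y)" if "y \<in> Y" for y
    using that X by (auto simp: Y_def numerators_def dest!: subsetD)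
  have b: "\<bar>t - b y\<bar> < \<delta>" if "y \<in> Y" for y
  proof -
    have "\<exists>k::int. \<bar>t - \<alpha> y - of_int k\<bar> < \<delta>" using that by (simp add: Y_def)
    then have "\<bar>t - \<alpha> y - of_int (k y)\<bar> < \<delta>" unfolding k_def by (rule someI_ex)
    then show ?thesis by (simp add: b_def algebra_simps)
  qed
  have bf: "\<bar>b y - f y\<bar> \<le> 1 / (real (snd y) * Q)" if "y \<in> Y" for y
    using \<alpha>[of "fst y" "snd y"] that by (simp add: b_def f_def Y_def)
  have gap: "1 / (real (snd y) * real (snd z)) \<le> \<bar>f y - f z\<bar>" if "y \<in> Y" "z \<in> Y" "y \<noteq> z" for y z
  proof -
    have "f y - f z \<noteq> 0"
    proof
      assume "f y - f z = 0"
      then have "real (fst y) / real (snd y) - real (fst z) / real (snd z) = of_int (k z - k y)"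
        by (simp add: f_def)
      from reduced_fraction_eq[OF q(3) q(3) this] that show False by (simp add: prod_eq_iff)
    qed
    moreover have "real (snd y * snd z) * (f y - f z)
       = of_int (int (fst y * snd z) - int (fst z * snd y) + (k y - k z) * int (snd y * snd z))"
      using q(1)[OF that(1)] q(1)[OF that(2)] by (simp add: f_def field_simps)
    then have "real (snd y * snd z) * (f y - f z) \<in> \<int>" by (metis Ints_of_int)
    ultimately show ?thesis using rational_gap[of "snd y * snd z" "f y - f z"] q(1) that by simp
  qed
  have gapQ: "1 / (Q * real (snd z)) \<le> \<bar>f y - f z\<bar>" if "y \<in> Y" "z \<in> Y" "y \<noteq> z" for y z
  proof (rule order.trans[OF _ gap[OF that]])
    show "1 / (Q * real (snd z)) \<le> 1 / (real (snd y) * real (snd z))"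
      using q(1,2)[OF that(1)] q(1,2)[OF that(2)] by (intro divide_left_mono mult_right_mono mult_pos_pos) auto
  qed
  have one: "card Z \<le> 1" if "Z \<subseteq> Y" and Z: "\<And>y z. y \<in> Z \<Longrightarrow> z \<in> Z \<Longrightarrow> y \<noteq> z \<Longrightarrow> f y \<le> f z \<Longrightarrow> False" for Z
  proof -
    have "y = z" if "y \<in> Z" "z \<in> Z" for y z
      using Z[of y z] Z[of z y] that by (cases "f y \<le> f z") auto
    then show ?thesis using card_le_Suc0_iff_eq[of Z] finite_subset[OF \<open>Z \<subseteq> Y\<close> finY] by auto
  qed
  have "card {y \<in> Y. f y \<le> t - \<delta>} \<le> 1"
  proof (rule one)
    fix y z assume y: "y \<in> {y \<in> Y. f y \<le> t - \<delta>}" and z: "z \<in> {y \<in> Y. f y \<le> t - \<delta>}"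
      and yz: "y \<noteq> z" "f y \<le> f z"
    have "1 / (real (snd y) * Q) \<le> f z - f y"
      using gapQ[of z y] y z yz by (simp add: mult.commute)
    then show False using bf[of y] b[of y] y z by (simp add: abs_if split: if_splits)
  qed auto
  moreover have "card {y \<in> Y. t + \<delta> \<le> f y} \<le> 1"
  proof (rule one)
    fix y z assume y: "y \<in> {y \<in> Y. t + \<delta> \<le> f y}" and z: "z \<in> {y \<in> Y. t + \<delta> \<le> f y}"
      and yz: "y \<noteq> z" "f y \<le> f z"
    have "1 / (real (snd z) * Q) \<le> f z - f y"
      using gapQ[of y z] y z yz by (simp add: mult.commute)
    then show False using bf[of z] b[of z] y z by (simp add: abs_if split: if_splits)
  qed auto
  moreover have "card {y \<in> Y. t - \<delta> < f y \<and> f y < t + \<delta>} \<le> 1"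
  proof (rule one)
    fix y z assume y: "y \<in> {y \<in> Y. t - \<delta> < f y \<and> f y < t + \<delta>}" and z: "z \<in> {y \<in> Y. t - \<delta> < f y \<and> f y < t + \<delta>}"
      and yz: "y \<noteq> z" "f y \<le> f z"
    have "1 / Q\<^sup>2 \<le> 1 / (Q * real (snd z))"
      unfolding power2_eq_square using q(1,2)[of z] z Q by (intro divide_left_mono mult_left_mono mult_pos_pos) auto
    also have "\<dots> \<le> f z - f y" using gapQ[of y z] y z yz by simp
    finally show False using y z \<delta> by simp
  qed auto
  moreover have "Y = {y \<in> Y. f y \<le> t - \<delta>} \<union> {y \<in> Y. t + \<delta> \<le> f y} \<union> {y \<in> Y. t - \<delta> < f y \<and> f y < t + \<delta>}"
    by auto
  then have "card Y \<le> card {y \<in> Y. f y \<le> t - \<delta>} + card {y \<in> Y. t + \<delta> \<le> f y}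
      + card {y \<in> Y. t - \<delta> < f y \<and> f y < t + \<delta>}"
    using card_Un_le[of "{y \<in> Y. f y \<le> t - \<delta>} \<union> {y \<in> Y. t + \<delta> \<le> f y}" "{y \<in> Y. t - \<delta> < f y \<and> f y < t + \<delta>}"]
      card_Un_le[of "{y \<in> Y. f y \<le> t - \<delta>}" "{y \<in> Y. t + \<delta> \<le> f y}"] by simp
  ultimately show ?thesis unfolding Y_def[symmetric] by linarith
qed

section \<open>Lifting an exponential sum to shifts by reduced fractions\<close>

lemma sum_roots_of_unity_prime:
  assumes "prime p" "\<not> p dvd n"
  shows "(\<Sum>j<p. e (real n / real p * real j)) = 0"
proof -
  have p: "p > 0" using assms(1) by (simp add: prime_gt_0_nat)
  have "e (real n / real p) \<noteq> 1"
  proof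
    assume "e (real n / real p) = 1"
    then obtain k :: int where "real n / real p = of_int k" by (auto simp: e_eq_1_iff elim: Ints_cases)
    then have "real_of_int (int n) = of_int (k * int p)" using p by (simp add: field_simps)
    then have "int n = k * int p" by (simp only: of_int_eq_iff)
    then have "int p dvd int n" by simp
    then show False using assms(2) by simp
  qed
  moreover have "e (real n / real p) ^ p = 1"
    using p e_int[of "int n"] by (simp flip: e_mult_nat)
  ultimately show ?thesis unfolding e_mult_nat by (simp add: geometric_sum)
qed

text \<open>The set \<open>U\<close> of all $b\le pr$ coprime to $r$ consists of \<open>p\<close> translates of the reduced residues
  modulo $r$, so the sum over \<open>U\<close> contains a complete sum of \<open>p\<close>-th roots of unity and vanishes.
  Those $b\in U$ that are coprime to \<open>p\<close> give the Ramanujan sum modulo $pr$. The others are $b=pc$ with $c$ reduced modulo $r$,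
  and they give the Ramanujan sum modulo $r$.\<close>

lemma ramanujan_sum_mult_prime:
  assumes p: "prime p" and pr: "coprime p r" and n: "coprime n (p * r)" and r: "r > 0"
  shows "(\<Sum>b\<in>numerators (p * r). e (real n * real b / real (p * r)))
       = - (\<Sum>b\<in>numerators r. e (real n * real b / real r))"
proof -
  define U where "U = {b. 1 \<le> b \<and> b \<le> p * r \<and> coprime b r}"
  define g where "g = (\<lambda>b. e (real n * real b / real (p * r)))"
  have p0: "p > 0" using p by (simp add: prime_gt_0_nat)
  have cop_shift: "coprime (b + j * r) r \<longleftrightarrow> coprime b r" for b j
    using gcd_add_mult[of r j b] unfolding coprime_iff_gcd_eq_1 by (metis add.commute gcd.commute)
  have ndvd: "\<not> p dvd n"
  proof
    assume "p dvd n"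
    moreover have "p dvd p * r" by simp
    ultimately have "is_unit p" using n by (rule coprime_common_divisor[rotated])
    then show False using p by simp
  qed
  have "sum g U = (\<Sum>(b, j)\<in>numerators r \<times> {..<p}. g (b + j * r))"
  proof (rule sum.reindex_bij_witness[where i = "\<lambda>(b, j). b + j * r" and j = "\<lambda>b. ((b - 1) mod r + 1, (b - 1) div r)"])
    fix b assume b: "b \<in> U"
    show "(case ((b - 1) mod r + 1, (b - 1) div r) of (b, j) \<Rightarrow> b + j * r) = b"
      using b by (simp add: U_def)
    have "coprime (Suc ((b - 1) mod r)) r"
    proof -
      have "b = Suc ((b - 1) mod r) + (b - 1) div r * r" using b by (simp add: U_def)
      then have "coprime (Suc ((b - 1) mod r) + (b - 1) div r * r) r" using b by (simp add: U_def)
      then show ?thesis by (simp only: cop_shift)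
    qed
    moreover have "(b - 1) div r < p"
    proof (rule less_mult_imp_div_less)
      show "b - 1 < p * r" using b unfolding U_def by auto
    qed
    ultimately show "((b - 1) mod r + 1, (b - 1) div r) \<in> numerators r \<times> {..<p}"
      using r by (simp add: numerators_def Suc_le_eq)
    show "(case ((b - 1) mod r + 1, (b - 1) div r) of (b, j) \<Rightarrow> g (b + j * r)) = g b"
      using b by (simp add: U_def)
  next
    fix z assume "z \<in> numerators r \<times> {..<p}"
    then obtain b j where z: "z = (b, j)" "b \<in> numerators r" "j < p" by auto
    then have b: "1 \<le> b" "b \<le> r" "coprime b r" by (auto simp: numerators_def)
    have "b + j * r - 1 = (b - 1) + j * r" using b by simp
    moreover have "b - 1 < r" using b r by simp
    ultimately have "(b + j * r - 1) mod r = b - 1" "(b + j * r - 1) div r = j"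
      using r by simp_all
    then show "(((case z of (b, j) \<Rightarrow> b + j * r) - 1) mod r + 1, ((case z of (b, j) \<Rightarrow> b + j * r) - 1) div r) = z"
      using \<open>(b + j * r - 1) mod r = b - 1\<close> \<open>(b + j * r - 1) div r = j\<close> b by (simp add: z)
    have "b + j * r \<le> p * r"
    proof -
      have "b + j * r \<le> (j + 1) * r" using b by simp
      also have "\<dots> \<le> p * r" using z by (intro mult_right_mono) auto
      finally show ?thesis .
    qed
    moreover have "coprime (b + j * r) r" using b by (simp only: cop_shift)
    ultimately show "(case z of (b, j) \<Rightarrow> b + j * r) \<in> U"
      using b by (simp add: z U_def)
  qed
  also have "\<dots> = (\<Sum>b\<in>numerators r. e (real n * real b / real (p * r)) * (\<Sum>j<p. e (real n / real p * real j)))"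
    unfolding sum.cartesian_product[symmetric] sum_distrib_left
    by (intro sum.cong refl) (use p0 r in \<open>simp add: g_def field_simps flip: e_add\<close>)
  also have "\<dots> = 0" by (simp only: sum_roots_of_unity_prime[OF p ndvd] mult_zero_right sum.neutral_const)
  finally have U0: "sum g U = 0" .
  have "U = numerators (p * r) \<union> (\<lambda>b. p * b) ` numerators r"
  proof (intro equalityI subsetI)
    fix b assume b: "b \<in> U"
    show "b \<in> numerators (p * r) \<union> (\<lambda>b. p * b) ` numerators r"
    proof (cases "p dvd b")
      case True
      then obtain c where "b = p * c" by (elim dvdE)
      then show ?thesis using b p0 by (auto simp: U_def numerators_def)
    next
      case False
      then have "coprime b p" using p by (metis coprime_commute prime_imp_coprime_nat)
      then show ?thesis using b by (auto simp: U_def numerators_def)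
    qed
  next
    fix b assume "b \<in> numerators (p * r) \<union> (\<lambda>b. p * b) ` numerators r"
    then show "b \<in> U" using pr p0 by (auto simp: U_def numerators_def)
  qed
  moreover have "numerators (p * r) \<inter> (\<lambda>b. p * b) ` numerators r = {}"
    using p by (auto simp: numerators_def)
  ultimately have "sum g U = sum g (numerators (p * r)) + sum g ((\<lambda>b. p * b) ` numerators r)"
    by (simp add: sum.union_disjoint)
  also have "sum g ((\<lambda>b. p * b) ` numerators r) = (\<Sum>b\<in>numerators r. e (real n * real b / real r))"
    using p0 by (subst sum.reindex) (auto simp: inj_on_def g_def mult_ac)
  finally show ?thesis using U0 unfolding g_def by (simp add: add_eq_0_iff2)
qed

text \<open>The sign \<open>s\<close> is the Moebius function of \<open>r\<close>. What matters is that it has modulus one and does not depend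
  on \<open>n\<close>.\<close>

lemma ramanujan_sum_squarefree:
  assumes "squarefree r"
  shows "\<exists>s. norm s = 1 \<and> (\<forall>n. coprime n r \<longrightarrow> (\<Sum>b\<in>numerators r. e (real n * real b / real r)) = s)"
  using assms
proof (induction r rule: less_induct)
  case (less r)
  show ?case
  proof (cases "r = 1")
    case True
    have "e (real n) = 1" for n using e_int[of "int n"] by simp
    then show ?thesis using True by (intro exI[of _ 1]) simp
  next
    case False
    then obtain p where p: "prime p" "p dvd r" using prime_factor_nat by blast
    then obtain r' where r': "r = p * r'" by (elim dvdE)
    have "r \<noteq> 0" using less.prems by (intro notI) simp
    then have "r' > 0" using r' by (cases r') auto
    have "\<not> p dvd r'"
    proof
      assume "p dvd r'"
      then have "p\<^sup>2 dvd r" by (simp add: r' power2_eq_square)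
      then have "p dvd 1" by (rule squarefreeD[OF less.prems])
      then show False using p by simp
    qed
    then have cop: "coprime p r'" using p(1) by (rule prime_imp_coprime[rotated])
    have "squarefree r'" using less.prems by (rule squarefree_mono[rotated]) (simp add: r')
    moreover have "r' < r" using \<open>r' > 0\<close> prime_gt_1_nat[OF p(1)] by (simp add: r')
    ultimately obtain s where s: "norm s = 1"
      "\<And>n. coprime n r' \<Longrightarrow> (\<Sum>b\<in>numerators r'. e (real n * real b / real r')) = s"
      using less.IH by blast
    show ?thesis
    proof (intro exI[of _ "- s"] conjI allI impI)
      fix n assume n: "coprime n r"
      then have "coprime n r'" by (simp add: r')
      then show "(\<Sum>b\<in>numerators r. e (real n * real b / real r)) = - s"
        using ramanujan_sum_mult_prime[OF p(1) cop n[unfolded r'] \<open>r' > 0\<close>] s(2) unfolding r' by simp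
    qed (use s in simp)
  qed
qed

text \<open>As the Ramanujan sum takes the same value \<open>s\<close> at all $n\in J$, the sum of
  $S(\alpha+b/r)$ over the reduced residues $b$ equals $s\,S(\alpha)$. Cauchy--Schwarz then costs only
  the number of residues, which is at most $r$. The inequality holds for every real $\alpha$, and this is why
  it survives the passage from the fractions to arbitrary points of the arcs.\<close>

lemma squarefree_lift:
  assumes r: "squarefree r" and J: "\<And>n. n \<in> J \<Longrightarrow> coprime n r"
  shows "1 / real r * (norm (\<Sum>n\<in>J. u n * e (\<alpha> * real n)))\<^sup>2
    \<le> (\<Sum>b\<in>numerators r. (norm (\<Sum>n\<in>J. u n * e ((\<alpha> + real b / real r) * real n)))\<^sup>2)"
proof -
  define S where "S = (\<lambda>\<alpha>. \<Sum>n\<in>J. u n * e (\<alpha> * real n))"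
  have r0: "r > 0" using r by (intro gr0I notI) simp
  obtain s where s: "norm s = 1"
    "\<And>n. coprime n r \<Longrightarrow> (\<Sum>b\<in>numerators r. e (real n * real b / real r)) = s"
    using ramanujan_sum_squarefree[OF r] by blast
  have "(\<Sum>b\<in>numerators r. S (\<alpha> + real b / real r))
      = (\<Sum>n\<in>J. \<Sum>b\<in>numerators r. u n * e (\<alpha> * real n) * e (real n * real b / real r))"
    unfolding S_def by (subst sum.swap) (simp add: ring_distribs e_add mult_ac)
  also have "\<dots> = (\<Sum>n\<in>J. u n * e (\<alpha> * real n) * s)"
    by (intro sum.cong refl) (simp add: s(2)[OF J] flip: sum_distrib_left)
  also have "\<dots> = S \<alpha> * s" by (simp add: S_def sum_distrib_right)
  finally have "norm (S \<alpha>) = norm (\<Sum>b\<in>numerators r. S (\<alpha> + real b / real r))"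
    by (simp add: norm_mult s(1))
  also have "\<dots> \<le> (\<Sum>b\<in>numerators r. 1 * norm (S (\<alpha> + real b / real r)))"
    by (simp add: norm_sum)
  finally have "(norm (S \<alpha>))\<^sup>2 \<le> (\<Sum>b\<in>numerators r. 1 * norm (S (\<alpha> + real b / real r)))\<^sup>2"
    by (rule power_mono) simp
  also have "\<dots> \<le> (\<Sum>b\<in>numerators r. 1\<^sup>2) * (\<Sum>b\<in>numerators r. (norm (S (\<alpha> + real b / real r)))\<^sup>2)"
    by (rule Cauchy_Schwarz_ineq_sum)
  also have "\<dots> \<le> real r * (\<Sum>b\<in>numerators r. (norm (S (\<alpha> + real b / real r)))\<^sup>2)"
    using card_numerators_le[of r] by (intro mult_right_mono sum_nonneg) auto
  finally show ?thesis unfolding S_def using r0 by (simp add: field_simps)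
qed

section \<open>Sums over sifted integers\<close>

definition sifted :: "nat \<Rightarrow> nat set \<Rightarrow> nat set" where
  "sifted n P = {r \<in> {1..n}. squarefree r \<and> (\<forall>p\<in>P. \<not> p dvd r)}"

lemma finite_sifted [simp]: "finite (sifted n P)"
  by (simp add: sifted_def)

text \<open>An element of \<open>sifted n P\<close> is either coprime to the prime \<open>p\<close> or \<open>p\<close> times an element
  coprime to \<open>p\<close>.\<close>

lemma sifted_insert:
  assumes p: "prime p"
  shows "(\<Sum>r\<in>sifted n P. 1 / real r) \<le> (1 + 1 / real p) * (\<Sum>r\<in>sifted n (insert p P). 1 / real r)"
proof -
  have p0: "p > 0" using p by (simp add: prime_gt_0_nat)
  have sub: "sifted n P \<subseteq> sifted n (insert p P) \<union> (\<lambda>r. p * r) ` sifted n (insert p P)"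
  proof
    fix r assume r: "r \<in> sifted n P"
    show "r \<in> sifted n (insert p P) \<union> (\<lambda>r. p * r) ` sifted n (insert p P)"
    proof (cases "p dvd r")
      case True
      then obtain s where s: "r = p * s" by (elim dvdE)
      have "\<not> p dvd s"
      proof
        assume "p dvd s"
        then have "p\<^sup>2 dvd r" by (simp add: s power2_eq_square)
        then show False using r p squarefreeD[of r p] by (simp add: sifted_def)
      qed
      moreover have "squarefree s"
        using r by (intro squarefree_mono[of s r]) (auto simp: sifted_def s)
      moreover note sq = calculation
      have "s \<le> p * s" using p0 by simp
      moreover have "p * s \<le> n" using r unfolding sifted_def s by simp
      ultimately have "s \<le> n" by linarith
      with sq have "squarefree s \<and> \<not> p dvd s \<and> s \<le> n" by simp
      moreover have "1 \<le> s" using r unfolding sifted_def s by (cases s) auto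
      moreover have "\<forall>q\<in>P. \<not> q dvd s" using r unfolding sifted_def s by auto
      ultimately have "s \<in> sifted n (insert p P)" by (simp add: sifted_def)
      then show ?thesis using s by blast
    qed (use r in \<open>simp add: sifted_def\<close>)
  qed
  have "(\<Sum>r\<in>sifted n P. 1 / real r)
      \<le> (\<Sum>r\<in>sifted n (insert p P) \<union> (\<lambda>r. p * r) ` sifted n (insert p P). 1 / real r)"
    by (rule sum_mono2[OF _ sub]) auto
  also have "\<dots> = (\<Sum>r\<in>sifted n (insert p P). 1 / real r) + (\<Sum>r\<in>(\<lambda>r. p * r) ` sifted n (insert p P). 1 / real r)"
    by (rule sum.union_disjoint) (auto simp: sifted_def)
  also have "(\<Sum>r\<in>(\<lambda>r. p * r) ` sifted n (insert p P). 1 / real r) = (\<Sum>r\<in>sifted n (insert p P). 1 / real p * (1 / real r))"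
    using p0 by (subst sum.reindex) (auto simp: inj_on_def)
  also have "\<dots> = 1 / real p * (\<Sum>r\<in>sifted n (insert p P). 1 / real r)"
    by (rule sum_distrib_left[symmetric])
  finally show ?thesis by (simp add: ring_distribs)
qed

text \<open>Every integer is a square times a squarefree integer, so the harmonic sum is at most
  $\sum_k k^{-2}$ times the sum over squarefree integers.\<close>

lemma ln_le_sifted_empty:
  "ln (real n + 1) \<le> 7 / 4 * (\<Sum>r\<in>sifted n {}. 1 / real r)"
proof -
  have sub: "{1..n} \<subseteq> (\<lambda>(k, r). r * k\<^sup>2) ` ({1..n} \<times> sifted n {})"
  proof
    fix m assume m: "m \<in> {1..n}"
    define k r where "k = square_part m" and "r = squarefree_part m"
    have mkr: "m = r * k\<^sup>2" unfolding k_def r_def by (rule squarefree_decompose)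
    have "r \<noteq> 0" "k \<noteq> 0" using mkr m by (auto intro!: Nat.gr0I)
    then have "k \<le> m" "r \<le> m" unfolding mkr power2_eq_square by auto
    moreover have "squarefree r" unfolding r_def by (rule squarefree_squarefree_part)
    ultimately have "(k, r) \<in> {1..n} \<times> sifted n {}"
      using \<open>r \<noteq> 0\<close> \<open>k \<noteq> 0\<close> m by (simp add: sifted_def)
    then show "m \<in> (\<lambda>(k, r). r * k\<^sup>2) ` ({1..n} \<times> sifted n {})"
      using mkr by (intro image_eqI[where x = "(k, r)"]) auto
  qed
  have "ln (real n + 1) \<le> (\<Sum>m\<in>{1..n}. 1 / real m)"
    using ln_le_harm[of n] by (simp add: harm_def inverse_eq_divide)
  also have "\<dots> \<le> (\<Sum>m\<in>(\<lambda>(k, r). r * k\<^sup>2) ` ({1..n} \<times> sifted n {}). 1 / real m)"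
    by (rule sum_mono2[OF _ sub]) auto
  also have "\<dots> \<le> (\<Sum>z\<in>{1..n} \<times> sifted n {}. ((\<lambda>m. 1 / real m) \<circ> (\<lambda>(k, r). r * k\<^sup>2)) z)"
    by (rule sum_image_le) auto
  also have "\<dots> = (\<Sum>k\<in>{1..n}. 1 / (real k)\<^sup>2) * (\<Sum>r\<in>sifted n {}. 1 / real r)"
    unfolding sum_product sum.cartesian_product by (intro sum.cong) auto
  also have "\<dots> \<le> 7 / 4 * (\<Sum>r\<in>sifted n {}. 1 / real r)"
    by (intro mult_right_mono sum_inverse_squares_le sum_nonneg) auto
  finally show ?thesis .
qed

lemma ln_le_sifted:
  assumes "finite P" "\<And>p. p \<in> P \<Longrightarrow> prime p"
  shows "ln (real n + 1) \<le> 7 / 4 * (\<Prod>p\<in>P. 1 + 1 / real p) * (\<Sum>r\<in>sifted n P. 1 / real r)"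
  using assms
proof (induction P rule: finite_induct)
  case empty
  show ?case using ln_le_sifted_empty by simp
next
  case (insert p P)
  have "ln (real n + 1) \<le> 7 / 4 * (\<Prod>p\<in>P. 1 + 1 / real p) * (\<Sum>r\<in>sifted n P. 1 / real r)"
    using insert by simp
  also have "\<dots> \<le> 7 / 4 * (\<Prod>p\<in>P. 1 + 1 / real p) * ((1 + 1 / real p) * (\<Sum>r\<in>sifted n (insert p P). 1 / real r))"
    using insert.prems by (intro mult_left_mono sifted_insert mult_nonneg_nonneg prod_nonneg) auto
  finally show ?case using insert.hyps by (simp add: mult_ac)
qed

definition primes_upto :: "nat \<Rightarrow> nat set" where
  "primes_upto n = {p. prime p \<and> p \<le> n}"

lemma finite_primes_upto [simp]: "finite (primes_upto n)"
  by (rule finite_subset[of _ "{..n}"]) (auto simp: primes_upto_def)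

lemma inverse_Suc_le_ln_diff:
  assumes "n > 0"
  shows "1 / real (Suc n) \<le> ln (real (Suc n)) - ln (real n)"
proof -
  have "ln (real n / real (Suc n)) \<le> real n / real (Suc n) - 1"
    using assms by (intro ln_le_minus_one) simp
  also have "real n / real (Suc n) - 1 = - (1 / real (Suc n))" by (simp add: field_simps)
  finally show ?thesis using assms by (subst (asm) ln_div) auto
qed

lemma ln_fact_le:
  assumes "n \<ge> 1"
  shows "ln (fact n :: real) \<le> real n * ln (real n) - real n + ln (real n) + 1"
  using assms
proof (induction n rule: dec_induct)
  case (step n)
  have n: "n > 0" using step by simp
  have "1 \<le> (real n + 1) * (ln (real n + 1) - ln (real n))"
    using inverse_Suc_le_ln_diff[OF n] by (simp add: field_simps)
  moreover have "ln (fact (Suc n) :: real) = ln (real n + 1) + ln (fact n)"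
    using n by (simp add: ln_mult add.commute)
  ultimately show ?case using step.IH by (simp add: algebra_simps)
qed simp

lemma sum_ln_primes_dvd_le:
  assumes "m > 0"
  shows "(\<Sum>p | prime p \<and> p dvd m. ln (real p)) \<le> ln (real m)"
proof -
  let ?A = "{p. prime p \<and> p dvd m}"
  have fin: "finite ?A" by (rule finite_subset[OF _ finite_divisors_nat[OF assms]]) auto
  have "[m = 0] (mod (\<Prod>p\<in>?A. p))"
    by (rule cong_cong_prod_coprime_nat) (auto simp: primes_coprime cong_0_iff)
  then have "\<Prod>?A dvd m" by (simp add: cong_0_iff)
  then have "\<Prod>?A \<le> m" using assms by (rule dvd_imp_le)
  have "(\<Sum>p\<in>?A. ln (real p)) = ln (\<Prod>p\<in>?A. real p)"
    by (rule ln_prod[symmetric]) (auto simp: prime_gt_0_nat fin)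
  also have "\<dots> \<le> ln (real m)"
  proof (subst ln_le_cancel_iff)
    show "0 < (\<Prod>p\<in>?A. real p)" by (intro prod_pos) (auto simp: prime_gt_0_nat)
    have "(\<Prod>p\<in>?A. real p) = real (\<Prod>?A)" by simp
    also have "\<dots> \<le> real m" using \<open>\<Prod>?A \<le> m\<close> by (simp only: of_nat_le_iff)
    finally show "(\<Prod>p\<in>?A. real p) \<le> real m" .
  qed (use assms in simp)
  finally show ?thesis .
qed

text \<open>An upper bound of Mertens type. In $\log n!=\sum_{m\le n}\log m\ge\sum_{m\le n}\sum_{p\mid m}\log p$ the prime
  $p\le n$ occurs $\lfloor n/p\rfloor\ge n/(2p)$ times. The true order of the sum is
  $\log n$; the factor 2 comes from the crude estimate of the integer part.\<close>

lemma mertens_upper: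
  assumes "n \<ge> 6"
  shows "(\<Sum>p\<in>primes_upto n. ln (real p) / real p) \<le> 2 * ln (real n) - 1"
proof -
  have cnt: "real n / (2 * real p) \<le> real (card {m \<in> {1..n}. p dvd m})" if "p \<in> primes_upto n" for p
  proof -
    have p: "0 < p" "p \<le> n" using that by (auto simp: primes_upto_def prime_gt_0_nat)
    have "(\<lambda>k. p * k) ` {1..n div p} \<subseteq> {m \<in> {1..n}. p dvd m}"
    proof safe
      fix k assume k: "k \<in> {1..n div p}"
      have "p * k \<le> p * (n div p)" using k by simp
      also have "\<dots> \<le> n" by simp
      finally show "p * k \<in> {1..n}" using k p by simp
    qed simp
    then have "card ((\<lambda>k. p * k) ` {1..n div p}) \<le> card {m \<in> {1..n}. p dvd m}"
      by (intro card_mono) auto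
    moreover have "card ((\<lambda>k. p * k) ` {1..n div p}) = n div p"
      using p by (subst card_image) (auto simp: inj_on_def)
    moreover have "real n \<le> 2 * real p * real (n div p)"
    proof -
      have "1 \<le> n div p" using p by (simp add: Suc_le_eq div_greater_zero_iff)
      then have "p * 1 \<le> p * (n div p)" by (rule mult_le_mono2)
      moreover have "n = p * (n div p) + n mod p" "n mod p < p" using p by auto
      ultimately have "n \<le> 2 * (p * (n div p))" by linarith
      then have "real n \<le> real (2 * (p * (n div p)))" by (simp only: of_nat_le_iff)
      then show ?thesis by simp
    qed
    ultimately have "real n / (2 * real p) \<le> real (n div p)" "n div p \<le> card {m \<in> {1..n}. p dvd m}"
      using p by (simp_all add: field_simps)
    then show ?thesis by linarith
  qed
  have "real n / 2 * (\<Sum>p\<in>primes_upto n. ln (real p) / real p)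
      = (\<Sum>p\<in>primes_upto n. ln (real p) * (real n / (2 * real p)))"
    by (simp add: sum_distrib_left mult_ac)
  also have "\<dots> \<le> (\<Sum>p\<in>primes_upto n. ln (real p) * real (card {m \<in> {1..n}. p dvd m}))"
    by (intro sum_mono mult_left_mono cnt) (auto simp: primes_upto_def prime_gt_0_nat Suc_le_eq intro!: ln_ge_zero)
  also have "\<dots> = (\<Sum>p\<in>primes_upto n. \<Sum>m | m \<in> {1..n} \<and> p dvd m. ln (real p))"
    by (simp add: mult.commute)
  also have "\<dots> = (\<Sum>m\<in>{1..n}. \<Sum>p | p \<in> primes_upto n \<and> p dvd m. ln (real p))"
    by (rule sum.swap_restrict) auto
  also have "\<dots> \<le> (\<Sum>m\<in>{1..n}. ln (real m))"
  proof (rule sum_mono)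
    fix m assume m: "m \<in> {1..n}"
    then have "{p. p \<in> primes_upto n \<and> p dvd m} = {p. prime p \<and> p dvd m}"
      by (auto simp: primes_upto_def dest: dvd_imp_le)
    then show "(\<Sum>p | p \<in> primes_upto n \<and> p dvd m. ln (real p)) \<le> ln (real m)"
      using sum_ln_primes_dvd_le[of m] m by simp
  qed
  also have "\<dots> = ln (\<Prod>m\<in>{1..n}. real m)" by (rule ln_prod[symmetric]) auto
  also have "\<dots> = ln (fact n)" by (simp add: fact_prod)
  also have "\<dots> \<le> real n * ln (real n) - real n + ln (real n) + 1"
    by (rule ln_fact_le) (use assms in simp)
  also have "\<dots> \<le> real n * ln (real n) - real n / 2"
  proof -
    have "(5 / 2 :: real) \<le> exp 1" using exp_lower_Taylor_quadratic[of 1] by simp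
    then have "(5 / 2)\<^sup>2 \<le> (exp 1 :: real)\<^sup>2" by (intro power_mono) auto
    also have "(exp 1 :: real)\<^sup>2 = exp 2" using exp_of_nat_mult[of 2 "1::real"] by simp
    finally have "ln 6 \<le> ln (exp (2::real))"
      by (subst ln_le_cancel_iff) (auto simp: power2_eq_square)
    moreover have "ln (real n / 6) \<le> real n / 6 - 1" using assms by (intro ln_le_minus_one) simp
    ultimately show ?thesis using assms by (simp add: ln_div)
  qed
  finally have "real n / 2 * (\<Sum>p\<in>primes_upto n. ln (real p) / real p) \<le> real n / 2 * (2 * ln (real n) - 1)"
    by (simp add: algebra_simps)
  then show ?thesis using assms by (subst (asm) mult_le_cancel_left_pos) auto
qed

text \<open>Terms with $\log d>T$ are negative, and the sum over all $d\le e^T$ compares with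
  $\int_1^{e^T}(T-\log x)\,dx/x=T^2/2$, whose primitive is \<open>G\<close>. The term $d=1$ accounts for the extra $T$.\<close>

lemma sum_harmonic_weighted:
  assumes T: "T \<ge> 0" and fin: "finite D" and D: "\<And>d. d \<in> D \<Longrightarrow> d > 0"
  shows "(\<Sum>d\<in>D. (T - ln (real d)) / real d) \<le> T\<^sup>2 / 2 + T"
proof -
  define G where "G = (\<lambda>n::nat. T * ln (real n) - (ln (real n))\<^sup>2 / 2)"
  define D' where "D' = {d. d > 0 \<and> ln (real d) \<le> T}"
  define n where "n = nat \<lfloor>exp T\<rfloor>"
  have D': "D' = {1..n}"
  proof -
    have "ln (real d) \<le> T \<longleftrightarrow> d \<le> n" if "d > 0" for d
    proof -
      have "ln (real d) \<le> T \<longleftrightarrow> real d \<le> exp T" using that by (metis exp_le_cancel_iff exp_ln of_nat_0_less_iff)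
      also have "\<dots> \<longleftrightarrow> d \<le> n" unfolding n_def by (simp add: le_nat_floor le_nat_iff le_floor_iff)
      finally show ?thesis .
    qed
    then show ?thesis unfolding D'_def by (auto simp: Suc_le_eq)
  qed
  have n1: "1 \<le> n" using T unfolding n_def by (simp add: le_nat_iff le_floor_iff)
  have "(\<Sum>d\<in>D. (T - ln (real d)) / real d) \<le> (\<Sum>d\<in>D \<inter> D'. (T - ln (real d)) / real d)"
  proof -
    have "(\<Sum>d\<in>D. (T - ln (real d)) / real d) = (\<Sum>d\<in>D \<inter> D'. (T - ln (real d)) / real d) + (\<Sum>d\<in>D - D'. (T - ln (real d)) / real d)"
      using fin by (metis (no_types, lifting) sum.Int_Diff)
    moreover have "(\<Sum>d\<in>D - D'. (T - ln (real d)) / real d) \<le> 0"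
      using D by (intro sum_nonpos) (auto simp: D'_def divide_nonpos_pos)
    ultimately show ?thesis by linarith
  qed
  also have "\<dots> \<le> (\<Sum>d\<in>{1..n}. (T - ln (real d)) / real d)"
  proof (rule sum_mono2)
    fix d assume "d \<in> {1..n} - D \<inter> D'"
    then have "d \<in> D'" unfolding D' by simp
    then show "0 \<le> (T - ln (real d)) / real d" by (simp add: D'_def)
  qed (use D' in auto)
  also have "\<dots> \<le> T + G n"
  proof -
    have "m \<le> n \<Longrightarrow> (\<Sum>d\<in>{1..m}. (T - ln (real d)) / real d) \<le> T + G m" if "1 \<le> m" for m
      using that
    proof (induction m rule: dec_induct)
      case (step m)
      have m: "m > 0" using step by simp
      define a b where "a = ln (real m)" and "b = ln (real (Suc m))"
      have ab: "a \<le> b" using m by (simp add: a_def b_def)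
      have "Suc m \<in> D'" using step D' by simp
      then have bT: "b \<le> T" by (simp add: D'_def b_def)
      have inv: "1 / real (Suc m) \<le> b - a"
        unfolding a_def b_def by (rule inverse_Suc_le_ln_diff) (fact m)
      have "(T - b) / real (Suc m) \<le> (b - a) * (T - b)"
        using mult_right_mono[OF inv, of "T - b"] bT by simp
      also have "\<dots> \<le> (b - a) * (T - (a + b) / 2)"
        using ab by (intro mult_left_mono) auto
      also have "\<dots> = G (Suc m) - G m"
        by (simp add: G_def a_def b_def power2_eq_square field_simps del: of_nat_Suc)
      finally have "(T - ln (real (Suc m))) / real (Suc m) \<le> G (Suc m) - G m" by (simp only: b_def)
      then show ?case using step.IH step.prems by simp
    qed (simp add: G_def)
    then show ?thesis using n1 by simp
  qed
  also have "G n \<le> T\<^sup>2 / 2"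
    using sum_squares_bound[of T "ln (real n)"] by (simp add: G_def)
  finally show ?thesis by simp
qed


text \<open>The product $B$ is $\sum_d 1/d$ over the squarefree $d$ composed of primes up to \<open>n\<close>. Under
  the weights $1/d$ the mean of $\log d$ is at most $\Lambda=\sum_{p\le n}(\log p)/p$, because a prime
  $p$ divides $d$ with proportion at most $1/p$. A small mean is incompatible with a large $B$: for every $T$,
  $B(T-\Lambda)\le\sum_d(T-\log d)/d\le T^2/2+T$ by \<open>sum_harmonic_weighted\<close>. With the bound
  $\Lambda\le\mu=2\log n-1$ and the choice $T=2\mu$ this gives $B\le 2\mu+2$.\<close>

lemma prod_primes_upto_le:
  assumes n: "n \<ge> 6"
  shows "(\<Prod>p\<in>primes_upto n. 1 + 1 / real p) \<le> 4 * ln (real n)"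
proof -
  define P where "P = primes_upto n"
  define B where "B = (\<Prod>p\<in>P. 1 + 1 / real p)"
  define \<Lambda> where "\<Lambda> = (\<Sum>p\<in>P. ln (real p) / real p)"
  define d where "d = (\<lambda>A::nat set. \<Prod>A)"
  define \<mu> where "\<mu> = 2 * ln (real n) - 1"
  have finP: "finite P" by (simp add: P_def)
  have prime: "prime p" if "p \<in> P" for p using that by (simp add: P_def primes_upto_def)
  have finA: "finite A" if "A \<in> Pow P" for A using that finP by (auto intro: finite_subset)
  have d_pos: "d A > 0" if "A \<in> Pow P" for A
    using that prime unfolding d_def by (intro prod_pos) (auto simp: prime_gt_0_nat)
  have d_inv: "A = {p \<in> P. p dvd d A}" if "A \<in> Pow P" for A
  proof -
    have "p \<in> A" if "p \<in> P" "p dvd d A" for p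
    proof -
      have "\<exists>q\<in>A. p dvd q"
        using that prime_dvd_prod_iff[OF finA[OF \<open>A \<in> Pow P\<close>] prime[OF that(1)], of id] by (simp add: d_def)
      then obtain q where "q \<in> A" "p dvd q" by blast
      moreover have "prime q" using \<open>q \<in> A\<close> \<open>A \<in> Pow P\<close> prime by auto
      ultimately show ?thesis using prime[OF that(1)] primes_dvd_imp_eq by blast
    qed
    moreover have "p dvd d A" if "p \<in> A" for p
      unfolding d_def using finA[OF \<open>A \<in> Pow P\<close>] that by (rule dvd_prodI[where f = id, simplified])
    ultimately show ?thesis using that by auto
  qed
  have inj: "inj_on d (Pow P)" by (rule inj_on_inverseI) (use d_inv in \<open>rule sym\<close>)
  have B_eq: "B = (\<Sum>A\<in>Pow P. 1 / real (d A))"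
    unfolding B_def by (subst add.commute, subst prod_add[OF finP]) (simp add: d_def prod_dividef)
  have B_pos: "0 < B" unfolding B_def by (intro prod_pos) (auto intro: add_pos_nonneg)
  have part: "(\<Sum>A | A \<in> Pow P \<and> p \<in> A. 1 / real (d A)) \<le> 1 / real p * B" if p: "p \<in> P" for p
  proof -
    have "(\<Sum>A | A \<in> Pow P \<and> p \<in> A. 1 / real (d A))
        = (\<Sum>A | A \<in> Pow P \<and> p \<in> A. 1 / real p * (1 / real (d (A - {p}))))"
    proof (rule sum.cong[OF refl])
      fix A assume "A \<in> {A. A \<in> Pow P \<and> p \<in> A}"
      then have "d A = p * d (A - {p})"
        unfolding d_def using finA[of A] by (intro prod.remove) auto
      then show "1 / real (d A) = 1 / real p * (1 / real (d (A - {p})))" by simp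
    qed
    also have "\<dots> = 1 / real p * (\<Sum>A\<in>(\<lambda>A. A - {p}) ` {A. A \<in> Pow P \<and> p \<in> A}. 1 / real (d A))"
      by (subst sum.reindex) (auto simp: inj_on_def sum_distrib_left)
    also have "\<dots> \<le> 1 / real p * B"
      unfolding B_eq by (intro mult_left_mono sum_mono2) (use finP in auto)
    finally show ?thesis .
  qed
  have "(\<Sum>A\<in>Pow P. ln (real (d A)) / real (d A))
      = (\<Sum>A\<in>Pow P. \<Sum>p | p \<in> P \<and> p \<in> A. ln (real p) * (1 / real (d A)))"
  proof (rule sum.cong[OF refl])
    fix A assume A: "A \<in> Pow P"
    have "ln (real (d A)) = (\<Sum>p\<in>A. ln (real p))"
      unfolding d_def of_nat_prod using A finA[OF A] prime by (subst ln_prod) (auto simp: prime_gt_0_nat)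
    moreover have "{p. p \<in> P \<and> p \<in> A} = A" using A by auto
    ultimately show "ln (real (d A)) / real (d A) = (\<Sum>p | p \<in> P \<and> p \<in> A. ln (real p) * (1 / real (d A)))"
      by (simp add: sum_divide_distrib)
  qed
  also have "\<dots> = (\<Sum>p\<in>P. \<Sum>A | A \<in> Pow P \<and> p \<in> A. ln (real p) * (1 / real (d A)))"
    by (rule sum.swap_restrict) (use finP in auto)
  also have "\<dots> = (\<Sum>p\<in>P. ln (real p) * (\<Sum>A | A \<in> Pow P \<and> p \<in> A. 1 / real (d A)))"
    by (simp only: sum_distrib_left)
  also have "\<dots> \<le> (\<Sum>p\<in>P. ln (real p) * (1 / real p * B))"
    by (intro sum_mono mult_left_mono part)
      (auto simp: Suc_le_eq prime_gt_0_nat dest: prime intro!: ln_ge_zero)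
  also have "\<dots> = B * \<Lambda>" by (simp add: \<Lambda>_def sum_distrib_left mult_ac)
  also have "\<dots> \<le> B * \<mu>"
    using mertens_upper[OF n] B_pos unfolding \<Lambda>_def \<mu>_def P_def by (intro mult_left_mono) auto
  finally have first_moment: "(\<Sum>A\<in>Pow P. ln (real (d A)) / real (d A)) \<le> B * \<mu>" .
  have "1 \<le> ln (real n)"
  proof -
    have "exp 1 \<le> real n" using exp_le n by simp
    then show ?thesis using n by (subst ln_ge_iff) auto
  qed
  then have \<mu>: "\<mu> > 0" by (simp add: \<mu>_def)
  have "2 * \<mu> * B - (\<Sum>A\<in>Pow P. ln (real (d A)) / real (d A))
      = (\<Sum>A\<in>Pow P. (2 * \<mu> - ln (real (d A))) / real (d A))"
    by (simp add: B_eq sum_distrib_left diff_divide_distrib sum_subtractf)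
  also have "\<dots> = (\<Sum>m\<in>d ` Pow P. (2 * \<mu> - ln (real m)) / real m)"
    by (simp add: sum.reindex[OF inj])
  also have "\<dots> \<le> (2 * \<mu>)\<^sup>2 / 2 + 2 * \<mu>"
    by (rule sum_harmonic_weighted) (use \<mu> finP d_pos in auto)
  finally have "\<mu> * B \<le> \<mu> * (2 * \<mu> + 2)"
    using first_moment by (simp add: power2_eq_square algebra_simps)
  then have "B \<le> 2 * \<mu> + 2" using \<mu> by (simp add: mult_le_cancel_left_pos)
  then show ?thesis unfolding B_def P_def \<mu>_def by simp
qed

section \<open>The large sieve with sifted shifts\<close>

text \<open>For a pair $(x,y)$ consider the fractions $f=b/r-c/s-k$, not integers, with
  $|\alpha_x-\alpha_y+f|<\delta$. Two of them are closer than $2\delta\le R^{-4}$, but their denominators divide $rs$ and $r's'$,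
  which are at most $R^2$, so they coincide. The common value has a reduced denominator $>1$,
  and any prime factor of it divides $rs$ for all representations of $f$. Sifting out one such prime
  per pair leaves only integral differences $b/r-c/s$. The primes added are not in \<open>P\<close>, since
  they divide integers that are already sifted by \<open>P\<close>.\<close>

lemma exceptional_primes:
  fixes \<alpha> :: "'i \<Rightarrow> real"
  assumes fin: "finite X" and \<delta>: "2 * \<delta> \<le> 1 / real R ^ 4"
  shows "\<exists>B. finite B \<and> card B \<le> (card X)\<^sup>2 \<and> (\<forall>p\<in>B. prime p \<and> p \<notin> P) \<and>
    (\<forall>x\<in>X. \<forall>y\<in>X. \<forall>r\<in>sifted R (P \<union> B). \<forall>s\<in>sifted R (P \<union> B). \<forall>b c. \<forall>k::int.
       \<bar>\<alpha> x + real b / real r - (\<alpha> y + real c / real s) - of_int k\<bar> < \<delta> \<longrightarrow>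
       real b / real r - real c / real s \<in> \<int>)"
proof -
  define W where "W = (\<lambda>x y f r s. r \<in> sifted R P \<and> s \<in> sifted R P \<and> f \<notin> \<int> \<and> real (r * s) * f \<in> \<int> \<and>
       \<bar>\<alpha> x - \<alpha> y + f\<bar> < \<delta>)"
  have "\<exists>p. (\<exists>f r s. W x y f r s) \<longrightarrow> prime p \<and> p \<notin> P \<and> (\<forall>f r s. W x y f r s \<longrightarrow> p dvd r * s)" for x y
  proof (cases "\<exists>f r s. W x y f r s")
    case True
    then obtain f r s where W: "W x y f r s" by blast
    then have rs: "1 \<le> r" "r \<le> R" "1 \<le> s" "s \<le> R" by (auto simp: W_def sifted_def)
    have "f = (real (r * s) * f) / real (r * s)" using rs by simp
    moreover have "real (r * s) * f \<in> \<rat>" using W Ints_subset_Rats by (auto simp: W_def)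
    ultimately have "f \<in> \<rat>" by (metis Rats_divide Rats_of_nat)
    then obtain m n :: nat where n: "n \<noteq> 0" and f: "\<bar>f\<bar> = real m / real n" and mn: "coprime m n"
      by (rule Rats_abs_nat_div_natE)
    have "n \<noteq> 1"
    proof
      assume "n = 1"
      then have "f = of_int (int m) \<or> f = of_int (- int m)" using f by auto
      then have "f \<in> \<int>" by (metis Ints_of_int)
      then show False using W by (simp add: W_def)
    qed
    then obtain p where p: "prime p" "p dvd n" using prime_factor_nat by blast
    have dvd: "p dvd r' * s'" if W': "W x y f' r' s'" for f' r' s'
    proof -
      have rs': "1 \<le> r'" "r' \<le> R" "1 \<le> s'" "s' \<le> R" using W' by (auto simp: W_def sifted_def)
      have "f = f'"
      proof (rule ccontr)
        assume "f \<noteq> f'"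
        have "real (r * s * (r' * s')) * (f - f') = real (r' * s') * (real (r * s) * f) - real (r * s) * (real (r' * s') * f')"
          by (simp add: algebra_simps)
        also have "\<dots> \<in> \<int>" using W W' unfolding W_def by (blast intro: Ints_diff Ints_mult Ints_of_nat)
        finally have "1 / real (r * s * (r' * s')) \<le> \<bar>f - f'\<bar>"
          using \<open>f \<noteq> f'\<close> rs rs' by (intro rational_gap) auto
        moreover have "r * s * (r' * s') \<le> R * R * (R * R)" using rs rs' by (intro mult_le_mono)
        then have "real (r * s * (r' * s')) \<le> real R ^ 4"
          by (simp add: power4_eq_xxxx flip: of_nat_mult)
        then have "1 / real R ^ 4 \<le> 1 / real (r * s * (r' * s'))"
          using rs rs' by (intro divide_left_mono mult_pos_pos) auto
        moreover have "\<bar>f - f'\<bar> < 2 * \<delta>" using W W' unfolding W_def by linarith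
        ultimately show False using \<delta> by linarith
      qed
      then have "real (r' * s') * f \<in> \<int>" using W' by (simp add: W_def)
      then have "\<bar>real (r' * s') * f\<bar> \<in> \<int>" by (rule Ints_abs)
      then have "real (r' * s') * (real m / real n) \<in> \<int>" by (simp add: abs_mult f)
      then obtain k where "real (r' * s') * (real m / real n) = of_int k" by (elim Ints_cases)
      then have "real_of_int (int (r' * s' * m)) = of_int (k * int n)" using n by (simp add: field_simps)
      then have "int (r' * s' * m) = k * int n" by (simp only: of_int_eq_iff)
      then have "int n dvd int (r' * s' * m)" by simp
      then have "n dvd r' * s' * m" by (simp only: int_dvd_int_iff)
      then have "n dvd r' * s'" using mn by (metis coprime_commute coprime_dvd_mult_left_iff)
      then show ?thesis using p(2) by (rule dvd_trans[rotated])
    qed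
    have "p dvd r \<or> p dvd s" using dvd[OF W] p(1) by (simp add: prime_dvd_mult_iff)
    then have "p \<notin> P" using W by (auto simp: W_def sifted_def)
    then show ?thesis using p(1) dvd by blast
  qed simp
  then obtain pr where pr: "\<And>x y. (\<exists>f r s. W x y f r s) \<Longrightarrow>
      prime (pr x y) \<and> pr x y \<notin> P \<and> (\<forall>f r s. W x y f r s \<longrightarrow> pr x y dvd r * s)" by metis
  define Z where "Z = {(x, y) \<in> X \<times> X. \<exists>f r s. W x y f r s}"
  define B where "B = (\<lambda>(x, y). pr x y) ` Z"
  have ZX: "Z \<subseteq> X \<times> X" by (auto simp: Z_def)
  have finXX: "finite (X \<times> X)" using fin by simp
  have finZ: "finite Z" by (rule finite_subset[OF ZX finXX])
  have "card Z \<le> card (X \<times> X)" by (rule card_mono[OF finXX ZX])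
  then have "card B \<le> (card X)\<^sup>2"
    using card_image_le[OF finZ, of "\<lambda>(x, y). pr x y"]
    by (simp add: B_def card_cartesian_product power2_eq_square)
  moreover have "\<forall>p\<in>B. prime p \<and> p \<notin> P"
    using pr by (auto simp: B_def Z_def)
  moreover have "real b / real r - real c / real s \<in> \<int>"
    if x: "x \<in> X" and y: "y \<in> X" and r: "r \<in> sifted R (P \<union> B)" and s: "s \<in> sifted R (P \<union> B)"
      and near: "\<bar>\<alpha> x + real b / real r - (\<alpha> y + real c / real s) - of_int k\<bar> < \<delta>" for x y r s b c and k :: int
  proof (rule ccontr)
    assume nin: "real b / real r - real c / real s \<notin> \<int>"
    define f where "f = real b / real r - real c / real s - of_int k"
    have "f \<notin> \<int>" using nin unfolding f_def by (metis Ints_add Ints_of_int diff_add_cancel)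
    moreover have rs: "r \<in> sifted R P" "s \<in> sifted R P" using r s by (auto simp: sifted_def)
    then have "1 \<le> r" "1 \<le> s" by (auto simp: sifted_def)
    then have "real (r * s) * f = of_int (int (b * s) - int (c * r) - k * int (r * s))"
      by (simp add: f_def field_simps)
    then have "real (r * s) * f \<in> \<int>" by (metis Ints_of_int)
    ultimately have W: "W x y f r s" using near rs by (simp add: W_def f_def algebra_simps)
    then have "pr x y \<in> B" using x y by (auto simp: B_def Z_def)
    moreover have "pr x y dvd r * s" "prime (pr x y)" using pr W by blast+
    then have "pr x y dvd r \<or> pr x y dvd s" by (simp add: prime_dvd_mult_iff)
    ultimately show False using r s by (auto simp: sifted_def)
  qed
  ultimately show ?thesis using finZ unfolding B_def by (intro exI[of _ "(\<lambda>(x, y). pr x y) ` Z"]) auto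
qed

text \<open>The large sieve at the points $\alpha_x+b/r$, with $r$ sifted and $b/r$ reduced. If two of them are
  close modulo 1, then \<open>sep\<close> forces $b/r=c/s$, so $\alpha_x$ and $\alpha_y$ are close as well: the
  enlarged family has the same multiplicity \<open>m\<close> as the original one, whereas \<open>squarefree_lift\<close>
  makes the left-hand side gain the sum of $1/r$.\<close>

lemma sifted_large_sieve:
  fixes \<alpha> :: "'i \<Rightarrow> real" and u :: "nat \<Rightarrow> complex"
  assumes fin: "finite X" and \<delta>: "\<delta> > 0" and K: "K > 0"
    and m: "\<And>x. x \<in> X \<Longrightarrow> card {y \<in> X. \<exists>k::int. \<bar>\<alpha> x - \<alpha> y - of_int k\<bar> < \<delta>} \<le> m"
    and J: "J \<subseteq> {n0..<n0+K}" and cop: "\<And>n r. n \<in> J \<Longrightarrow> r \<in> sifted R P \<Longrightarrow> coprime n r"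
    and sep: "\<And>x y r s b c (k::int). \<lbrakk>x \<in> X; y \<in> X; r \<in> sifted R P; s \<in> sifted R P;
       \<bar>\<alpha> x + real b / real r - (\<alpha> y + real c / real s) - of_int k\<bar> < \<delta>\<rbrakk>
       \<Longrightarrow> real b / real r - real c / real s \<in> \<int>"
  shows "(\<Sum>r\<in>sifted R P. 1 / real r) * (\<Sum>x\<in>X. (norm (\<Sum>n\<in>J. u n * e (\<alpha> x * real n)))\<^sup>2)
     \<le> 2 * real m * (real K + 1 / (real K * \<delta>\<^sup>2)) * (\<Sum>n\<in>J. (norm (u n))\<^sup>2)"
proof -
  define S where "S = (\<lambda>t. (norm (\<Sum>n\<in>J. u n * e (t * real n)))\<^sup>2)"
  define I where "I = X \<times> (SIGMA r:sifted R P. numerators r)"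
  define pt where "pt = (\<lambda>(x, r, b). \<alpha> x + real b / real r)"
  have finI: "finite I" using fin by (simp add: I_def)
  have "(\<Sum>r\<in>sifted R P. 1 / real r) * (\<Sum>x\<in>X. S (\<alpha> x)) = (\<Sum>x\<in>X. \<Sum>r\<in>sifted R P. 1 / real r * S (\<alpha> x))"
    by (subst mult.commute) (simp add: sum_product mult.commute)
  also have "\<dots> \<le> (\<Sum>x\<in>X. \<Sum>r\<in>sifted R P. \<Sum>b\<in>numerators r. S (\<alpha> x + real b / real r))"
    unfolding S_def by (intro sum_mono squarefree_lift cop) (auto simp: sifted_def)
  also have "\<dots> = (\<Sum>i\<in>I. S (pt i))"
    unfolding I_def pt_def by (simp add: sum.Sigma sum.cartesian_product case_prod_unfold)
  also have "\<dots> \<le> 2 * real m * (real K + 1 / (real K * \<delta>\<^sup>2)) * (\<Sum>n\<in>J. (norm (u n))\<^sup>2)"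
    unfolding S_def
  proof (rule large_sieve[OF finI \<delta> K _ J])
    fix i assume i: "i \<in> I"
    obtain x r b where xrb: "i = (x, r, b)" by (cases i)
    define near where "near = {j \<in> I. \<exists>k::int. \<bar>pt i - pt j - of_int k\<bar> < \<delta>}"
    have near: "y \<in> X \<and> s = r \<and> c = b \<and> (\<exists>k::int. \<bar>\<alpha> x - \<alpha> y - of_int k\<bar> < \<delta>)"
      if "(y, s, c) \<in> near" for y s c
    proof -
      have "\<exists>k::int. \<bar>\<alpha> x + real b / real r - (\<alpha> y + real c / real s) - of_int k\<bar> < \<delta>"
        using that by (simp add: near_def xrb pt_def)
      then obtain k :: int where k: "\<bar>\<alpha> x + real b / real r - (\<alpha> y + real c / real s) - of_int k\<bar> < \<delta>"
        by blast
      have mem: "x \<in> X" "r \<in> sifted R P" "b \<in> numerators r" "y \<in> X" "s \<in> sifted R P" "c \<in> numerators s"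
        using i that by (auto simp: near_def I_def xrb)
      have "real b / real r - real c / real s \<in> \<int>" by (rule sep[OF mem(1,4,2,5) k])
      then obtain l where "real b / real r - real c / real s = of_int l" by (elim Ints_cases)
      then have "b = c \<and> r = s" by (rule reduced_fraction_eq[OF mem(3,6)])
      then show ?thesis using k mem by auto
    qed
    have "inj_on fst near"
    proof (rule inj_onI)
      fix j j' assume "j \<in> near" "j' \<in> near" "fst j = fst j'"
      moreover obtain y s c y' s' c' where "j = (y, s, c)" "j' = (y', s', c')" by (cases j; cases j')
      ultimately show "j = j'" using near[of y s c] near[of y' s' c'] by simp
    qed
    then have "card near = card (fst ` near)" by (simp add: card_image)
    also have "\<dots> \<le> card {y \<in> X. \<exists>k::int. \<bar>\<alpha> x - \<alpha> y - of_int k\<bar> < \<delta>}"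
    proof (rule card_mono)
      show "fst ` near \<subseteq> {y \<in> X. \<exists>k::int. \<bar>\<alpha> x - \<alpha> y - of_int k\<bar> < \<delta>}"
      proof
        fix y assume "y \<in> fst ` near"
        then obtain s c where "(y, s, c) \<in> near" by force
        from near[OF this] show "y \<in> {y \<in> X. \<exists>k::int. \<bar>\<alpha> x - \<alpha> y - of_int k\<bar> < \<delta>}" by blast
      qed
    qed (use fin in simp)
    also have "\<dots> \<le> m" using i by (intro m) (simp add: I_def xrb)
    finally show "card {j \<in> I. \<exists>k::int. \<bar>pt i - pt j - of_int k\<bar> < \<delta>} \<le> m"
      by (simp add: near_def)
  qed
  finally show ?thesis by (simp add: S_def)
qed

text \<open>The pair $(a,q)$ stands for the fraction $a/q$.\<close>

definition farey :: "real \<Rightarrow> (nat \<times> nat) set" where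
  "farey Q = {(a, q). real q \<le> Q \<and> a \<in> numerators q}"

lemma farey_eq:
  "farey Q = (\<lambda>(q, a). (a, q)) ` (SIGMA q:{1..nat \<lfloor>Q\<rfloor>}. numerators q)"
proof -
  have "real q \<le> Q \<longleftrightarrow> q \<le> nat \<lfloor>Q\<rfloor>" if "1 \<le> q" for q :: nat
  proof -
    have "real q \<le> Q \<longleftrightarrow> int q \<le> \<lfloor>Q\<rfloor>" by (simp add: le_floor_iff)
    then show ?thesis using that by linarith
  qed
  then show ?thesis by (auto simp: farey_def numerators_def image_iff)
qed

lemma finite_farey [simp]: "finite (farey Q)"
  by (simp add: farey_eq)

text \<open>For $q\ge 2$ there are at most $q-1$ numerators, and $1+1+2+\dots+(n-1)\le n^2/2$ once $n\ge 2$. The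
  factor 1/2 enters squared into the count of exceptional primes.\<close>

lemma card_farey_le:
  assumes "Q \<ge> 2"
  shows "real (card (farey Q)) \<le> Q\<^sup>2 / 2"
proof -
  define n where "n = nat \<lfloor>Q\<rfloor>"
  have n: "2 \<le> n" "real n \<le> Q" using assms by (auto simp: n_def le_nat_floor)
  have num: "card (numerators q) \<le> q - 1" if "2 \<le> q" for q
  proof -
    have "numerators q \<subseteq> {1..q - 1}"
    proof
      fix a assume a: "a \<in> numerators q"
      then have "a \<noteq> q" using that by (auto simp: numerators_def)
      then show "a \<in> {1..q - 1}" using a by (auto simp: numerators_def)
    qed
    then show ?thesis using card_mono[of "{1..q - 1}" "numerators q"] by simp
  qed
  have "2 * (\<Sum>q\<in>{1..m}. card (numerators q)) \<le> m\<^sup>2" if "2 \<le> m" for m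
    using that
  proof (induction m rule: dec_induct)
    case base
    have "{1..2::nat} = {1, 2}" by auto
    then show ?case using num[of 2] card_numerators_le[of 1] by (simp add: power2_eq_square)
  next
    case (step m)
    then show ?case using num[of "Suc m"] by (simp add: power2_eq_square)
  qed
  then have "2 * (\<Sum>q\<in>{1..n}. card (numerators q)) \<le> n\<^sup>2" using n by simp
  moreover have "card (farey Q) = (\<Sum>q\<in>{1..n}. card (numerators q))"
    unfolding farey_eq n_def by (subst card_image) (auto simp: inj_on_def)
  ultimately have "real (2 * card (farey Q)) \<le> real (n\<^sup>2)" by (simp only: of_nat_le_iff)
  also have "\<dots> \<le> Q\<^sup>2" using n by (simp add: power_mono)
  finally show ?thesis by simp
qed

lemma farey_large_sieve:
  fixes \<alpha> :: "nat \<times> nat \<Rightarrow> real"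
  assumes Q: "Q > 0" and K: "K > 0" and J: "J \<subseteq> {n0..<n0+K}"
    and \<alpha>: "\<And>a q. (a, q) \<in> farey Q \<Longrightarrow> \<bar>\<alpha> (a, q) - real a / real q\<bar> \<le> 1 / (real q * Q)"
  shows "(\<Sum>x\<in>farey Q. (norm (\<Sum>n\<in>J. u n * e (\<alpha> x * real n)))\<^sup>2)
     \<le> 6 * (real K + 4 * Q ^ 4 / real K) * (\<Sum>n\<in>J. (norm (u n))\<^sup>2)"
proof -
  define \<delta> where "\<delta> = 1 / (2 * Q\<^sup>2)"
  have "(\<Sum>x\<in>farey Q. (norm (\<Sum>n\<in>J. u n * e (\<alpha> x * real n)))\<^sup>2)
     \<le> 2 * real 3 * (real K + 1 / (real K * \<delta>\<^sup>2)) * (\<Sum>n\<in>J. (norm (u n))\<^sup>2)"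
  proof (rule large_sieve[OF finite_farey _ K _ J])
    fix i
    show "card {j \<in> farey Q. \<exists>k::int. \<bar>\<alpha> i - \<alpha> j - of_int k\<bar> < \<delta>} \<le> 3"
      by (rule major_arc_points_spaced[OF _ finite_farey Q \<alpha>]) (auto simp: farey_def \<delta>_def)
  qed (use Q in \<open>simp add: \<delta>_def\<close>)
  also have "1 / (real K * \<delta>\<^sup>2) = 4 * Q ^ 4 / real K"
    by (simp add: \<delta>_def field_simps power_mult_distrib flip: power_mult)
  finally show ?thesis by simp
qed

text \<open>This is Minkowski's inequality followed by Cauchy--Schwarz. When the coefficients are split into two
  sets, the constants \<open>A\<close> and \<open>B\<close> of the two parts add up, so a part with a tiny
  constant is almost free.\<close>

lemma sum_norm_add_squared_le:
  fixes f g :: "'i \<Rightarrow> complex"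
  assumes A: "A > 0" and B: "B > 0"
    and f: "(\<Sum>x\<in>X. (norm (f x))\<^sup>2) \<le> A * U" and g: "(\<Sum>x\<in>X. (norm (g x))\<^sup>2) \<le> B * V"
  shows "(\<Sum>x\<in>X. (norm (f x + g x))\<^sup>2) \<le> (A + B) * (U + V)"
proof -
  have "(norm (f x + g x))\<^sup>2 \<le> (A + B) * ((norm (f x))\<^sup>2 / A + (norm (g x))\<^sup>2 / B)" for x
  proof -
    define s t where "s = norm (f x)" and "t = norm (g x)"
    have "(norm (f x + g x))\<^sup>2 \<le> (s + t)\<^sup>2"
      unfolding s_def t_def by (intro power_mono norm_triangle_ineq) simp
    also have "(A + B) * (s\<^sup>2 / A + t\<^sup>2 / B) - (s + t)\<^sup>2 = (B * s - A * t)\<^sup>2 / (A * B)"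
      using A B by (simp add: field_simps power2_eq_square)
    then have "(s + t)\<^sup>2 \<le> (A + B) * (s\<^sup>2 / A + t\<^sup>2 / B)"
      using A B by (metis diff_ge_0_iff_ge divide_nonneg_pos mult_pos_pos zero_le_power2)
    finally show ?thesis by (simp add: s_def t_def)
  qed
  then have "(\<Sum>x\<in>X. (norm (f x + g x))\<^sup>2) \<le> (\<Sum>x\<in>X. (A + B) * ((norm (f x))\<^sup>2 / A + (norm (g x))\<^sup>2 / B))"
    by (rule sum_mono)
  also have "\<dots> = (A + B) * ((\<Sum>x\<in>X. (norm (f x))\<^sup>2) / A + (\<Sum>x\<in>X. (norm (g x))\<^sup>2) / B)"
    by (simp add: sum.distrib sum_divide_distrib flip: sum_distrib_left)
  also have "\<dots> \<le> (A + B) * (U + V)"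
    using A B f g by (intro mult_left_mono add_mono) (auto simp: field_simps)
  finally show ?thesis .
qed

lemma norm_sum_e_squared_le:
  assumes "finite J"
  shows "(norm (\<Sum>n\<in>J. u n * e (t * real n)))\<^sup>2 \<le> real (card J) * (\<Sum>n\<in>J. (norm (u n))\<^sup>2)"
proof -
  have "norm (\<Sum>n\<in>J. u n * e (t * real n)) \<le> (\<Sum>n\<in>J. 1 * norm (u n))"
    by (rule order.trans[OF norm_sum]) (simp add: norm_mult)
  then have "(norm (\<Sum>n\<in>J. u n * e (t * real n)))\<^sup>2 \<le> (\<Sum>n\<in>J. 1 * norm (u n))\<^sup>2"
    by (rule power_mono) simp
  also have "\<dots> \<le> (\<Sum>n\<in>J. 1\<^sup>2) * (\<Sum>n\<in>J. (norm (u n))\<^sup>2)"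
    by (rule Cauchy_Schwarz_ineq_sum)
  finally show ?thesis by simp
qed

section \<open>Numerical bounds and the two ranges of the parameter\<close>

lemma prod_exceptional_le:
  assumes fin: "finite B" and z: "z > 0" and B: "\<And>p. p \<in> B \<Longrightarrow> real p \<ge> z"
    and card: "real (card B) \<le> z / 4"
  shows "(\<Prod>p\<in>B. 1 + 1 / real p) \<le> 4 / 3"
proof -
  have "(\<Prod>p\<in>B. 1 + 1 / real p) \<le> (\<Prod>p\<in>B. exp (1 / z))"
  proof (rule prod_mono)
    fix p assume p: "p \<in> B"
    have "1 / real p \<le> 1 / z" using B[OF p] z by (intro divide_left_mono) auto
    then show "0 \<le> 1 + 1 / real p \<and> 1 + 1 / real p \<le> exp (1 / z)"
      using exp_ge_add_one_self[of "1 / z"] by (intro conjI) (simp, linarith)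
  qed
  also have "\<dots> = exp (real (card B) / z)" by (simp flip: exp_of_nat_mult)
  also have "\<dots> \<le> exp (1 / 4)" using card z by (simp add: field_simps)
  also have "\<dots> \<le> 4 / 3"
    using exp_ge_add_one_self[of "- (1 / 4)"] by (simp add: exp_minus field_simps)
  finally show ?thesis .
qed

text \<open>The primes up to $Q^4$ contribute at most $4\log Q^4$ to the product and the exceptional ones at
  most 4/3. The constant is $\frac74\cdot 16\cdot\frac43=\frac{112}3$.\<close>

lemma ln_le_sifted_exceptional:
  assumes Q: "Q \<ge> 2" and n: "n = nat \<lfloor>Q ^ 4\<rfloor>" and fin: "finite B"
    and B: "\<And>p. p \<in> B \<Longrightarrow> prime p \<and> p \<notin> primes_upto n"
    and card: "real (card B) \<le> Q ^ 4 / 4"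
  shows "ln (real R + 1) \<le> 112 / 3 * ln Q * (\<Sum>r\<in>sifted R (primes_upto n \<union> B). 1 / real r)"
proof -
  have "2 ^ 4 \<le> Q ^ 4" using Q by (intro power_mono) auto
  then have "16 \<le> Q ^ 4" by simp
  then have n6: "6 \<le> n" unfolding n by linarith
  have nQ: "real n \<le> Q ^ 4" unfolding n using Q by simp
  have Qn: "Q ^ 4 < real n + 1" unfolding n using Q by linarith
  have "ln (real n) \<le> ln (Q ^ 4)" using n6 nQ by (subst ln_le_cancel_iff) auto
  then have small: "(\<Prod>p\<in>primes_upto n. 1 + 1 / real p) \<le> 16 * ln Q"
    using prod_primes_upto_le[OF n6] Q by (simp add: ln_realpow)
  have large: "(\<Prod>p\<in>B. 1 + 1 / real p) \<le> 4 / 3"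
  proof (rule prod_exceptional_le[OF fin _ _ card])
    fix p assume "p \<in> B"
    then have "n < p" using B[of p] by (auto simp: primes_upto_def)
    then show "Q ^ 4 \<le> real p" using Qn by linarith
  qed (use Q in simp)
  have "(\<Prod>p\<in>primes_upto n \<union> B. 1 + 1 / real p)
      = (\<Prod>p\<in>primes_upto n. 1 + 1 / real p) * (\<Prod>p\<in>B. 1 + 1 / real p)"
    using fin B by (intro prod.union_disjoint) auto
  also have "\<dots> \<le> 16 * ln Q * (4 / 3)"
    using Q by (intro mult_mono small large prod_nonneg) (auto intro: add_nonneg_nonneg)
  finally have prod: "(\<Prod>p\<in>primes_upto n \<union> B. 1 + 1 / real p) \<le> 64 / 3 * ln Q" by simp
  have "ln (real R + 1) \<le> 7 / 4 * (\<Prod>p\<in>primes_upto n \<union> B. 1 + 1 / real p)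
      * (\<Sum>r\<in>sifted R (primes_upto n \<union> B). 1 / real r)"
    using fin B by (intro ln_le_sifted) (auto simp: primes_upto_def)
  also have "\<dots> \<le> 7 / 4 * (64 / 3 * ln Q) * (\<Sum>r\<in>sifted R (primes_upto n \<union> B). 1 / real r)"
    using prod by (intro mult_right_mono mult_left_mono sum_nonneg) auto
  finally show ?thesis by simp
qed

text \<open>The at most $(Q^2/2)^2=Q^4/4$ pairs of points produce at most $Q^4/4$ exceptional primes, all of them larger
  than $Q^4$. This balance is the reason for sifting by the primes up to $Q^4$.\<close>

lemma farey_large_sieve_primes:
  fixes \<alpha> :: "nat \<times> nat \<Rightarrow> real"
  assumes Q: "Q \<ge> 2" and R: "R \<ge> 1" and RQ: "Q \<le> real R" and K: "K > 0" and J: "J \<subseteq> {n0..<n0+K}"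
    and prime: "\<And>n. n \<in> J \<Longrightarrow> prime n \<and> n > R"
    and \<alpha>: "\<And>a q. (a, q) \<in> farey Q \<Longrightarrow> \<bar>\<alpha> (a, q) - real a / real q\<bar> \<le> 1 / (real q * Q)"
  shows "ln (real R + 1) * (\<Sum>x\<in>farey Q. (norm (\<Sum>n\<in>J. u n * e (\<alpha> x * real n)))\<^sup>2)
     \<le> 224 * ln Q * (real K + 4 * real R ^ 8 / real K) * (\<Sum>n\<in>J. (norm (u n))\<^sup>2)"
proof -
  define \<delta> where "\<delta> = 1 / (2 * real R ^ 4)"
  define n where "n = nat \<lfloor>Q ^ 4\<rfloor>"
  define V where "V = (\<Sum>x\<in>farey Q. (norm (\<Sum>n\<in>J. u n * e (\<alpha> x * real n)))\<^sup>2)"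
  have V: "V \<ge> 0" by (simp add: V_def sum_nonneg)
  have \<delta>: "\<delta> > 0" using R by (simp add: \<delta>_def)
  have "2 * \<delta> \<le> 1 / real R ^ 4" by (simp add: \<delta>_def)
  from exceptional_primes[OF finite_farey[of Q] this, of "primes_upto n" \<alpha>]
  obtain B where B: "finite B" "card B \<le> (card (farey Q))\<^sup>2" "\<forall>p\<in>B. prime p \<and> p \<notin> primes_upto n"
    and sep: "\<forall>x\<in>farey Q. \<forall>y\<in>farey Q. \<forall>r\<in>sifted R (primes_upto n \<union> B). \<forall>s\<in>sifted R (primes_upto n \<union> B). \<forall>b c. \<forall>k::int.
       \<bar>\<alpha> x + real b / real r - (\<alpha> y + real c / real s) - of_int k\<bar> < \<delta> \<longrightarrow>
       real b / real r - real c / real s \<in> \<int>" by blast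
  define P where "P = primes_upto n \<union> B"
  have "real (card B) \<le> real ((card (farey Q))\<^sup>2)" using B(2) by (simp only: of_nat_le_iff)
  also have "\<dots> \<le> (Q\<^sup>2 / 2)\<^sup>2" unfolding of_nat_power by (intro power_mono card_farey_le Q) simp
  also have "\<dots> = Q ^ 4 / 4" by (simp add: power_divide flip: power_mult)
  finally have cardB: "real (card B) \<le> Q ^ 4 / 4" .
  have ln: "ln (real R + 1) \<le> 112 / 3 * ln Q * (\<Sum>r\<in>sifted R P. 1 / real r)"
    unfolding P_def by (rule ln_le_sifted_exceptional[OF Q n_def B(1) _ cardB]) (use B in blast)
  have "Q\<^sup>2 \<le> real R ^ 2" using Q RQ by (intro power_mono) auto
  also have "\<dots> \<le> real R ^ 4" using R by (intro power_increasing) auto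
  finally have Q2: "2 * \<delta> \<le> 1 / Q\<^sup>2"
    using Q R unfolding \<delta>_def by (simp add: divide_left_mono)
  have sieve: "(\<Sum>r\<in>sifted R P. 1 / real r) * V
     \<le> 2 * real 3 * (real K + 1 / (real K * \<delta>\<^sup>2)) * (\<Sum>n\<in>J. (norm (u n))\<^sup>2)"
    unfolding V_def
  proof (rule sifted_large_sieve[OF finite_farey \<delta> K _ J])
    fix x
    show "card {y \<in> farey Q. \<exists>k::int. \<bar>\<alpha> x - \<alpha> y - of_int k\<bar> < \<delta>} \<le> 3"
      using Q by (intro major_arc_points_spaced[OF _ finite_farey _ \<alpha> Q2]) (auto simp: farey_def)
  next
    fix m r assume "m \<in> J" and r: "r \<in> sifted R P"
    then have "prime m" "\<not> m dvd r" using prime[of m] r by (auto simp: sifted_def dest: dvd_imp_le)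
    then show "coprime m r" by (rule prime_imp_coprime)
  next
    fix x y r s b c and k :: int
    assume "x \<in> farey Q" "y \<in> farey Q" "r \<in> sifted R P" "s \<in> sifted R P"
       "\<bar>\<alpha> x + real b / real r - (\<alpha> y + real c / real s) - of_int k\<bar> < \<delta>"
    then show "real b / real r - real c / real s \<in> \<int>" using sep unfolding P_def by blast
  qed
  have "ln (real R + 1) * V \<le> 112 / 3 * ln Q * ((\<Sum>r\<in>sifted R P. 1 / real r) * V)"
    using mult_right_mono[OF ln V] by (simp only: mult.assoc)
  also have "\<dots> \<le> 112 / 3 * ln Q * (2 * real 3 * (real K + 1 / (real K * \<delta>\<^sup>2)) * (\<Sum>n\<in>J. (norm (u n))\<^sup>2))"
    using Q by (intro mult_left_mono sieve) auto
  also have "1 / (real K * \<delta>\<^sup>2) = 4 * real R ^ 8 / real K"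
    using R K by (simp add: \<delta>_def field_simps power_mult_distrib flip: power_mult)
  finally show ?thesis by (simp add: V_def algebra_simps)
qed

text \<open>Here the primality of \<open>n\<close> gives no gain: the large sieve for the arcs costs about $30N$, and
  $1200\log Q/\log N\ge 1200/39>30$.\<close>

lemma farey_prime_bound_large_Q:
  fixes N Q :: real
  assumes N: "N \<ge> 1000" and Q: "2 \<le> Q" "Q \<le> sqrt N" and lnN: "ln N \<le> 39 * ln Q"
    and K: "K = nat \<lfloor>N\<rfloor>" and J: "J \<subseteq> {n0..<n0+K}"
    and \<alpha>: "\<And>a q. (a, q) \<in> farey Q \<Longrightarrow> \<bar>\<alpha> (a, q) - real a / real q\<bar> \<le> 1 / (real q * Q)"
  shows "(\<Sum>x\<in>farey Q. (norm (\<Sum>n\<in>J. u n * e (\<alpha> x * real n)))\<^sup>2)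
     \<le> 1200 * (N * ln Q / ln N) * (\<Sum>n\<in>J. (norm (u n))\<^sup>2)"
proof -
  have KN: "real K \<le> N" "999 / 1000 * N \<le> real K" using N unfolding K by linarith+
  then have K0: "real K > 0" using N by linarith
  have "Q\<^sup>2 \<le> (sqrt N)\<^sup>2" using Q by (intro power_mono) auto
  then have "Q\<^sup>2 \<le> N" using N by simp
  then have "(Q\<^sup>2)\<^sup>2 \<le> N\<^sup>2" by (intro power_mono) auto
  then have "Q ^ 4 \<le> N * N" by (simp add: power2_eq_square power4_eq_xxxx mult.assoc)
  moreover have "999 * (N * N) \<le> 1000 * (N * real K)"
    using KN N by (simp add: mult_left_mono)
  ultimately have "999 * Q ^ 4 \<le> 1000 * N * real K" by linarith
  then have "4 * Q ^ 4 / real K \<le> 4000 / 999 * N" using K0 by (simp add: field_simps)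
  moreover have "6 * (real K + t) \<le> 1200 * N * (1 / 39)" if "t \<le> 4000 / 999 * N" for t
    using that KN N by (simp add: field_simps)
  ultimately have const: "6 * (real K + 4 * Q ^ 4 / real K) \<le> 1200 * N * (1 / 39)" by blast
  have "0 < ln N" using N by simp
  then have "1 / 39 \<le> ln Q / ln N" using lnN by (simp add: field_simps)
  then have "1200 * N * (1 / 39) \<le> 1200 * N * (ln Q / ln N)" using N by (intro mult_left_mono) auto
  with const have "6 * (real K + 4 * Q ^ 4 / real K) \<le> 1200 * (N * ln Q / ln N)" by simp
  moreover have "(\<Sum>x\<in>farey Q. (norm (\<Sum>n\<in>J. u n * e (\<alpha> x * real n)))\<^sup>2)
     \<le> 6 * (real K + 4 * Q ^ 4 / real K) * (\<Sum>n\<in>J. (norm (u n))\<^sup>2)"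
    by (rule farey_large_sieve[OF _ _ J \<alpha>]) (use Q K0 in auto)
  ultimately show ?thesis
    by (meson mult_right_mono order.trans sum_nonneg zero_le_power2)
qed

text \<open>With $R=\lfloor N^{1/5}\rfloor$ the term $R^8/K$ of the sifted large sieve is negligible against
  $K\le N$, and $\log N\le 5\log(R+1)$, so the primes above $R$ cost about $5\cdot 224=1120$ times $N\log Q/\log N$. The primes up to $R$ escape
  the lifting, but they are so few that Cauchy--Schwarz suffices for them. The numerical estimates
  rest on $N\ge Q^{39}$, which makes $w=N^{1/5}$ at least $Q^7\ge 128$.\<close>

lemma farey_prime_bound_small_Q:
  fixes N Q :: real
  assumes N: "N \<ge> 1000" and Q: "2 \<le> Q" and lnN: "39 * ln Q \<le> ln N"
    and K: "K = nat \<lfloor>N\<rfloor>" and J: "J \<subseteq> {n0..<n0+K}" and prime: "\<And>n. n \<in> J \<Longrightarrow> prime n"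
    and \<alpha>: "\<And>a q. (a, q) \<in> farey Q \<Longrightarrow> \<bar>\<alpha> (a, q) - real a / real q\<bar> \<le> 1 / (real q * Q)"
  shows "(\<Sum>x\<in>farey Q. (norm (\<Sum>n\<in>J. u n * e (\<alpha> x * real n)))\<^sup>2)
     \<le> 1200 * (N * ln Q / ln N) * (\<Sum>n\<in>J. (norm (u n))\<^sup>2)"
proof -
  define w where "w = N powr (1 / 5)"
  define R where "R = nat \<lfloor>w\<rfloor>"
  define E where "E = N * ln Q / ln N"
  define J1 where "J1 = {n \<in> J. n \<le> R}"
  define J2 where "J2 = {n \<in> J. R < n}"
  define U where "U = (\<lambda>J. \<Sum>n\<in>J. (norm (u n))\<^sup>2)"
  \<comment> \<open>$224\cdot 5\cdot 1001/1000=1121.12$ is the cost of the primes above \<open>R\<close>, and the rest of the 1200 is kept for \<open>A\<close>.\<close>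
  define A B where "A = Q\<^sup>2 / 2 * real R" and "B = 1122 * E"
  have U0: "0 \<le> U J" for J by (simp add: U_def sum_nonneg)
  have w0: "w > 0" using N by (simp add: w_def)
  have w5: "w ^ 5 = N" using N by (simp add: w_def powr_powr flip: powr_realpow)
  have lnw: "ln w = ln N / 5" using N by (simp add: w_def ln_powr)
  have lnQ: "1 / 2 \<le> ln Q" 
  proof -
    have "exp (1 / 2 :: real) \<le> 2"
      using exp_ge_add_one_self[of "- (1 / 2) :: real"] by (simp add: exp_minus field_simps)
    then show ?thesis using Q by (subst ln_ge_iff) auto
  qed
  have lnN0: "0 < ln N" using N by simp
  have E0: "E > 0" using N lnQ lnN0 by (simp add: E_def)
  have w7: "Q ^ 7 \<le> w"
  proof -
    have "ln (Q ^ 7) \<le> ln w" using lnN lnw lnQ Q by (simp add: ln_realpow)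
    then show ?thesis using Q w0 by (subst (asm) ln_le_cancel_iff) auto
  qed
  moreover have "(2::real) ^ 7 \<le> Q ^ 7" using Q by (intro power_mono) auto
  ultimately have w128: "128 \<le> w" by simp
  have "Q + 1 \<le> Q ^ 7"
  proof -
    have "2 * Q \<le> Q * Q" using Q by (intro mult_right_mono) auto
    then have "Q + 1 \<le> Q ^ 2" unfolding power2_eq_square using Q by linarith
    also have "\<dots> \<le> Q ^ 7" using Q by (intro power_increasing) auto
    finally show ?thesis .
  qed
  then have Qw: "Q + 1 \<le> w" using w7 by simp
  have R: "real R \<le> w" "w < real R + 1" using w0 unfolding R_def by linarith+
  have R1: "1 \<le> R" "Q \<le> real R" using R Qw w128 by linarith+
  have KN: "real K \<le> N" "N / 2 \<le> real K" using N unfolding K by linarith+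
  then have K0: "real K > 0" using N by linarith
  have "real R ^ 8 \<le> w ^ 8" using R by (intro power_mono) auto
  also have "\<dots> = N * w ^ 3" by (simp flip: w5 power_add)
  also have "\<dots> \<le> 2 * real K * w ^ 3" using KN w0 by (intro mult_right_mono) auto
  finally have "4 * real R ^ 8 / real K \<le> 8 * w ^ 3" using K0 by (simp add: field_simps)
  also have "\<dots> \<le> N / 1000"
  proof -
    have "128 * 128 \<le> w * w" using w128 by (intro mult_mono) auto
    then have "8000 * w ^ 3 \<le> (w * w) * w ^ 3" using w0 by (intro mult_right_mono) auto
    also have "\<dots> = N" by (simp add: eval_nat_numeral flip: w5)
    finally show ?thesis by simp
  qed
  finally have R8: "real K + 4 * real R ^ 8 / real K \<le> 1001 / 1000 * N" using KN by simp
  have lnR: "ln N / 5 \<le> ln (real R + 1)"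
    unfolding lnw[symmetric] using w0 R by (subst ln_le_cancel_iff) auto
  have B: "(\<Sum>x\<in>farey Q. (norm (\<Sum>n\<in>J2. u n * e (\<alpha> x * real n)))\<^sup>2) \<le> B * U J2" (is "?V \<le> _")
  proof -
    have "ln N / 5 * ?V \<le> ln (real R + 1) * ?V"
      by (intro mult_right_mono lnR sum_nonneg) auto
    also have "\<dots> \<le> 224 * ln Q * (real K + 4 * real R ^ 8 / real K) * U J2"
      unfolding U_def
      by (rule farey_large_sieve_primes[OF Q R1 _ _ _ \<alpha>]) (use K0 J prime in \<open>auto simp: J2_def\<close>)
    also have "\<dots> \<le> 224 * ln Q * (1001 / 1000 * N) * U J2"
      using lnQ by (intro mult_right_mono mult_left_mono R8 U0) auto
    finally have "?V \<le> 1121120 / 1000 * E * U J2"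
      using lnN0 by (simp add: E_def field_simps)
    also have "\<dots> \<le> B * U J2" unfolding B_def using E0 by (intro mult_right_mono U0) auto
    finally show ?thesis .
  qed
  have A: "(\<Sum>x\<in>farey Q. (norm (\<Sum>n\<in>J1. u n * e (\<alpha> x * real n)))\<^sup>2) \<le> A * U J1"
  proof -
    have "J1 \<subseteq> {1..R}" using prime by (auto simp: J1_def Suc_le_eq prime_gt_0_nat)
    then have fin: "finite J1" and card: "card J1 \<le> R"
      using finite_subset card_mono[of "{1..R}" J1] by auto
    have "(\<Sum>x\<in>farey Q. (norm (\<Sum>n\<in>J1. u n * e (\<alpha> x * real n)))\<^sup>2) \<le> (\<Sum>x\<in>farey Q. real R * U J1)"
      by (intro sum_mono order.trans[OF norm_sum_e_squared_le[OF fin]])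
        (use card in \<open>auto simp: U_def intro!: mult_right_mono sum_nonneg\<close>)
    also have "\<dots> = real (card (farey Q)) * (real R * U J1)" by simp
    also have "\<dots> \<le> Q\<^sup>2 / 2 * (real R * U J1)"
      by (intro mult_right_mono card_farey_le Q mult_nonneg_nonneg U0) simp
    finally show ?thesis by (simp add: A_def mult.assoc)
  qed
  have "A + B \<le> 1200 * E"
  proof -
    have "Q\<^sup>2 \<le> w\<^sup>2" using Qw Q by (intro power_mono) auto
    then have "A \<le> w\<^sup>2 / 2 * w" unfolding A_def using R by (intro mult_mono) auto
    moreover have "w ^ 4 / 10 \<le> E"
    proof -
      have "ln w \<le> w" using w0 ln_le_minus_one[of w] by linarith
      then have "ln N \<le> 5 * w" using lnw by simp
      then have "N * (1 / 2) / (5 * w) \<le> N * ln Q / ln N"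
        using N lnQ lnN0 w0 by (intro frac_le mult_left_mono mult_nonneg_nonneg) auto
      moreover have "N * (1 / 2) / (5 * w) = w ^ 4 / 10"
        unfolding w5[symmetric] using w0 by (simp add: field_simps eval_nat_numeral)
      ultimately show ?thesis unfolding E_def by (simp only:)
    qed
    moreover have "w\<^sup>2 / 2 * w \<le> w ^ 4 / 10"
    proof -
      have "5 * w ^ 3 \<le> w * w ^ 3" using w128 by (intro mult_right_mono) auto
      then show ?thesis by (simp add: eval_nat_numeral)
    qed
    ultimately show ?thesis unfolding B_def using E0 by linarith
  qed
  have finJ: "finite J" using J finite_subset by blast
  have J_split: "sum f J = sum f J1 + sum f J2" for f :: "nat \<Rightarrow> 'b::comm_monoid_add"
  proof -
    have "J = J1 \<union> J2" "J1 \<inter> J2 = {}" by (auto simp: J1_def J2_def)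
    then show ?thesis using finJ by (metis finite_Un sum.union_disjoint)
  qed
  have A0: "A > 0" and B0: "B > 0" using Q R1 E0 by (auto simp: A_def B_def)
  have "(\<Sum>x\<in>farey Q. (norm (\<Sum>n\<in>J. u n * e (\<alpha> x * real n)))\<^sup>2) \<le> (A + B) * (U J1 + U J2)"
    unfolding J_split by (rule sum_norm_add_squared_le[OF A0 B0 A B])
  also have "\<dots> \<le> 1200 * E * (U J1 + U J2)"
    by (intro mult_right_mono \<open>A + B \<le> 1200 * E\<close> add_nonneg_nonneg U0)
  finally show ?thesis by (simp add: E_def U_def J_split)
qed

theorem corollary10p6:
  fixes N M Q\<^sub>0 :: real and u :: "nat \<Rightarrow> complex"
  assumes "N \<ge> 1000" and "M \<ge> 0" and "2 \<le> Q\<^sub>0" and "Q\<^sub>0 \<le> sqrt N"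
  shows "(\<Sum>q\<in>{q::nat. 1 \<le> q \<and> real q \<le> Q\<^sub>0}. \<Sum>a\<in>{a::nat. 1 \<le> a \<and> a \<le> q \<and> coprime a q}.
            (SUP \<alpha>\<in>major_arc Q\<^sub>0 a q. (norm (exp_sum u M N \<alpha>))\<^sup>2))
         \<le> 1200 * (N * ln Q\<^sub>0 / ln N) * (\<Sum>p\<in>primes_between (M + 1) (M + N). (norm (u p))\<^sup>2)"
proof -
  define J where "J = primes_between (M + 1) (M + N)"
  define K where "K = nat \<lfloor>N\<rfloor>"
  define n0 where "n0 = nat \<lceil>M + 1\<rceil>"
  have Q: "Q\<^sub>0 > 0" using assms by simp
  obtain \<beta> where \<beta>: "\<And>a q. \<beta> a q \<in> major_arc Q\<^sub>0 a q"
    and sup: "\<And>a q. (SUP \<alpha>\<in>major_arc Q\<^sub>0 a q. (norm (exp_sum u M N \<alpha>))\<^sup>2) = (norm (exp_sum u M N (\<beta> a q)))\<^sup>2"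
    using SUP_major_arc_attained[OF Q, of _ _ u M N] by metis
  define \<alpha> where "\<alpha> = (\<lambda>(a, q). \<beta> a q)"
  have \<alpha>: "\<bar>\<alpha> (a, q) - real a / real q\<bar> \<le> 1 / (real q * Q\<^sub>0)" for a q
    using \<beta>[of a q] by (simp add: \<alpha>_def major_arc_def)
  have J: "J \<subseteq> {n0..<n0+K}"
  proof
    fix p assume "p \<in> J"
    then have p: "M + 1 \<le> real p" "real p \<le> M + N" by (auto simp: J_def primes_between_def)
    have "n0 \<le> p" unfolding n0_def using p assms by linarith
    moreover have "M + 1 \<le> real n0" "N < real K + 1"
      unfolding n0_def K_def using assms by linarith+
    then have "p < n0 + K" using p by linarith
    ultimately show "p \<in> {n0..<n0+K}" by simp
  qed
  have fin: "finite {q::nat. 1 \<le> q \<and> real q \<le> Q\<^sub>0}"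
    by (rule finite_subset[of _ "{..nat \<lfloor>Q\<^sub>0\<rfloor>}"]) (auto simp: le_nat_floor)
  have "(\<Sum>q\<in>{q::nat. 1 \<le> q \<and> real q \<le> Q\<^sub>0}. \<Sum>a\<in>{a::nat. 1 \<le> a \<and> a \<le> q \<and> coprime a q}.
            (SUP \<alpha>\<in>major_arc Q\<^sub>0 a q. (norm (exp_sum u M N \<alpha>))\<^sup>2))
      = (\<Sum>(q, a)\<in>(SIGMA q:{q::nat. 1 \<le> q \<and> real q \<le> Q\<^sub>0}. numerators q). (norm (exp_sum u M N (\<beta> a q)))\<^sup>2)"
    unfolding sup numerators_def[symmetric] by (rule sum.Sigma) (use fin in auto)
  also have "\<dots> = (\<Sum>x\<in>farey Q\<^sub>0. (norm (exp_sum u M N (\<alpha> x)))\<^sup>2)"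
    by (rule sum.reindex_bij_witness[where i = "\<lambda>(a, q). (q, a)" and j = "\<lambda>(q, a). (a, q)"])
      (auto simp: farey_def \<alpha>_def numerators_def)
  also have "\<dots> = (\<Sum>x\<in>farey Q\<^sub>0. (norm (\<Sum>p\<in>J. u p * e (\<alpha> x * real p)))\<^sup>2)"
    by (simp add: exp_sum_def J_def)
  also have "\<dots> \<le> 1200 * (N * ln Q\<^sub>0 / ln N) * (\<Sum>p\<in>J. (norm (u p))\<^sup>2)"
  proof (cases "ln N \<le> 39 * ln Q\<^sub>0")
    case True
    then show ?thesis
      using assms by (intro farey_prime_bound_large_Q[OF _ _ _ _ K_def J \<alpha>]) auto
  next
    case False
    then show ?thesis
      using assms by (intro farey_prime_bound_small_Q[OF _ _ _ K_def J _ \<alpha>])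
        (auto simp: J_def primes_between_def)
  qed
  finally show ?thesis by (simp add: J_def)
qed

end
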